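(* Let $(\xi_i)_{i\in\mathbb{Z}}$ be i.i.d. centered random variables with finite second moment $\sigma^2=\mathbb{E}\xi_0^2$. Assume that for a certain $t>2$ and a slowly varying function $h$ one has $\mathbb{P}(\xi_0\ge x)=h(x)/x^t$ as $x\to\infty$ (i.e. for all sufficiently large $x$). Let $c_{ni}>0$ ($n\ge1$, $1\le i\le k_n$) be constants, $S_n=\sum_{i=1}^{k_n}c_{ni}\xi_i$, $\sigma_n^2=\mathrm{var}(S_n)=\sigma^2\sum_{i=1}^{k_n}c_{ni}^2$, and assume $\max_{1\le i\le k_n}c_{ni}^2/\sigma_n^2\to0$ as $n\to\infty$. Put $D_{nt}=\big(\sum_{i=1}^{k_n}c_{ni}^2\big)^{-t/2}\sum_{i=1}^{k_n}c_{ni}^t$. Then, for any sequence $x_n\ge C_t(\ln D_{nt}^{-1})^{1/2}$ with a constant $C_t>e^{t/2}(t+2)/\sqrt2$, $$\mathbb{P}(S_n\ge x_n\sigma_n)=(1+o(1))\sum_{i=1}^{k_n}\mathbb{P}(c_{ni}\xi_0\ge x_n\sigma_n)\quad\text{as }n\to\infty.$$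
   Context: $k_n$ are positive integers. A (measurable, eventually positive) function $h$ is slowly varying if $\lim_{x\to\infty}h(\lambda x)/h(x)=1$ for all $\lambda>0$. $o(1)$ denotes a sequence, which may depend on $(x_n)$ and on the underlying distribution, converging to $0$ as $n\to\infty$. *)

theory Defs
  imports "HOL-Probability.Probability"
begin

(* h is a total function on the reals; only its behaviour near infinity matters, so a function
   given on a half-line (a, infinity) is to be extended by 0. *)
definition slowly_varying :: "(real \<Rightarrow> real) \<Rightarrow> bool" where
  "slowly_varying h \<longleftrightarrow>
     h \<in> borel_measurable borel \<and>
     eventually (\<lambda>x. h x > 0) at_top \<and>
     (\<forall>l>0. ((\<lambda>x. h (l * x) / h x) \<longlongrightarrow> 1) at_top)"

definition iid :: "'a measure \<Rightarrow> (int \<Rightarrow> 'a \<Rightarrow> real) \<Rightarrow> bool" where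
  "iid M \<xi> \<longleftrightarrow>
     prob_space.indep_vars M (\<lambda>_. borel) \<xi> UNIV \<and>
     (\<forall>i. distr M borel (\<xi> i) = distr M borel (\<xi> 0))"

definition weighted_sum ::
    "(nat \<Rightarrow> nat) \<Rightarrow> (nat \<Rightarrow> nat \<Rightarrow> real) \<Rightarrow> (int \<Rightarrow> 'a \<Rightarrow> real) \<Rightarrow> nat \<Rightarrow> 'a \<Rightarrow> real" where
  "weighted_sum k c \<xi> n \<omega> = (\<Sum>i=1..k n. c n i * \<xi> (int i) \<omega>)"

definition sd_sum ::
    "'a measure \<Rightarrow> (nat \<Rightarrow> nat) \<Rightarrow> (nat \<Rightarrow> nat \<Rightarrow> real) \<Rightarrow> (int \<Rightarrow> 'a \<Rightarrow> real) \<Rightarrow> nat \<Rightarrow> real" where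
  "sd_sum M k c \<xi> n = sqrt (prob_space.variance M (weighted_sum k c \<xi> n))"

definition D_ratio :: "(nat \<Rightarrow> nat) \<Rightarrow> (nat \<Rightarrow> nat \<Rightarrow> real) \<Rightarrow> real \<Rightarrow> nat \<Rightarrow> real" where
  "D_ratio k c t n =
     (\<Sum>i=1..k n. (c n i)\<^sup>2) powr (- t / 2) * (\<Sum>i=1..k n. c n i powr t)"

lemma sd_sum_squared:
  assumes "prob_space M" and "iid M \<xi>"
    and "integrable M (\<lambda>\<omega>. (\<xi> 0 \<omega>)\<^sup>2)" and "prob_space.expectation M (\<xi> 0) = 0"
  shows "(sd_sum M k c \<xi> n)\<^sup>2 =
    prob_space.expectation M (\<lambda>\<omega>. (\<xi> 0 \<omega>)\<^sup>2) * (\<Sum>i=1..k n. (c n i)\<^sup>2)"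
proof -
  interpret prob_space M by fact
  have ind: "indep_vars (\<lambda>_. borel) \<xi> UNIV"
    and dd: "\<And>i. distr M borel (\<xi> i) = distr M borel (\<xi> 0)"
    using assms(2) unfolding iid_def by blast+
  have rv [measurable]: "\<xi> i \<in> borel_measurable M" for i
    using ind by (auto simp: indep_vars_def)
  have sq: "integrable M (\<lambda>\<omega>. (\<xi> i \<omega>)\<^sup>2)" for i
    using assms(3) dd[of i] integrable_distr_eq[OF rv[of i], of "\<lambda>x. x\<^sup>2"]
      integrable_distr_eq[OF rv[of 0], of "\<lambda>x. x\<^sup>2"] by simp
  have int: "integrable M (\<xi> i)" for i
  proof (rule Bochner_Integration.integrable_bound)
    show "integrable M (\<lambda>\<omega>. 1 + (\<xi> i \<omega>)\<^sup>2)"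
      using sq by simp
    have "\<bar>y\<bar> \<le> 1 + y\<^sup>2" for y :: real
      using sum_squares_bound[of "\<bar>y\<bar>" 1] by (simp add: add.commute)
    then show "AE \<omega> in M. norm (\<xi> i \<omega>) \<le> norm (1 + (\<xi> i \<omega>)\<^sup>2)"
      by (simp add: abs_of_nonneg)
  qed simp
  have e0: "expectation (\<xi> i) = 0" for i
    using assms(4) dd[of i] integral_distr[OF rv[of i], of "\<lambda>x. x"]
      integral_distr[OF rv[of 0], of "\<lambda>x. x"] by simp
  have e2: "expectation (\<lambda>\<omega>. (\<xi> i \<omega>)\<^sup>2) = expectation (\<lambda>\<omega>. (\<xi> 0 \<omega>)\<^sup>2)" for i
    using dd[of i] integral_distr[OF rv[of i], of "\<lambda>x. x\<^sup>2"]
      integral_distr[OF rv[of 0], of "\<lambda>x. x\<^sup>2"] by simp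
  have cr: "integrable M (\<lambda>\<omega>. \<xi> i \<omega> * \<xi> j \<omega>) \<and>
      expectation (\<lambda>\<omega>. \<xi> i \<omega> * \<xi> j \<omega>) = (if i = j then expectation (\<lambda>\<omega>. (\<xi> 0 \<omega>)\<^sup>2) else 0)" for i j
  proof (cases "i = j")
    case True
    then show ?thesis using sq[of j] e2[of j] by (simp add: power2_eq_square)
  next
    case False
    have *: "indep_vars (\<lambda>_. borel) \<xi> {i, j}"
      using indep_vars_subset[OF ind] by simp
    show ?thesis
      using indep_vars_integrable[OF _ *] indep_vars_lebesgue_integral[OF _ *] int e0 False
      by simp
  qed
  have mean: "expectation (weighted_sum k c \<xi> n) = 0"
    unfolding weighted_sum_def using int e0 by simp
  have "(weighted_sum k c \<xi> n \<omega>)\<^sup>2 =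
      (\<Sum>i=1..k n. \<Sum>j=1..k n. c n i * c n j * (\<xi> (int i) \<omega> * \<xi> (int j) \<omega>))" for \<omega>
    unfolding weighted_sum_def power2_eq_square sum_product by (simp add: mult_ac)
  then have "variance (weighted_sum k c \<xi> n) =
      (\<Sum>i=1..k n. \<Sum>j=1..k n. c n i * c n j * expectation (\<lambda>\<omega>. \<xi> (int i) \<omega> * \<xi> (int j) \<omega>))"
    using cr by (simp add: mean)
  also have "\<dots> = (\<Sum>i=1..k n. c n i * c n i * expectation (\<lambda>\<omega>. (\<xi> 0 \<omega>)\<^sup>2))"
    by (simp add: cr[THEN conjunct2] if_distrib cong: if_cong)
  finally show ?thesis
    unfolding sd_sum_def using variance_positive[of "weighted_sum k c \<xi> n"]
    by (simp add: power2_eq_square sum_distrib_left mult_ac)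
qed

end

theory Submission
  imports Defs "HOL-Real_Asymp.Real_Asymp"
begin

text \<open>
  After normalising to variance one, write \<open>S = \<Sum> b i * Z i\<close> with \<open>\<Sum> (b i)\<^sup>2 = 1\<close>, and let
  \<open>G l = \<Sum> P(b i * Z i \<ge> l * x)\<close>. Regular variation gives \<open>G l \<sim> l powr - t * G 1\<close>, and \<open>G l\<close>
  tends to 0. The event \<open>S \<ge> x\<close> is essentially that exactly one summand exceeds \<open>(1 \<plusminus> s) * x\<close>
  while the sum of the others stays below \<open>s * x\<close>: two summands above \<open>e * x\<close> have probability
  at most \<open>(G e)\<^sup>2\<close>, and one such summand with the rest beyond \<open>s * x\<close> at most
  \<open>G e / (s * x)\<^sup>2\<close> by Chebyshev. There remains the event that \<open>S \<ge> x\<close> with all summands below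
  \<open>e * x\<close>. For \<open>2 < q < t\<close> a Fuk-Nagaev inequality bounds it by a multiple of
  \<open>exp (- exp (- q) * x\<^sup>2 / 2)\<close> plus a power of \<open>max b / x\<close>, which is as high as desired when \<open>e\<close>
  is small. Both are negligible because \<open>G 1\<close> is at least a multiple of
  \<open>(max b / x) powr (2 * t - 2)\<close> and of \<open>x powr (2 - 2 * t) * D\<^sup>2\<close>, where the growth condition on
  \<open>x\<close> gives \<open>D\<^sup>2 \<ge> exp (- 2 * x\<^sup>2 / C\<^sup>2)\<close>.
\<close>

section \<open>Sums of independent variables with one large summand\<close>

context prob_space
begin

lemma integrable_of_square:
  fixes X :: "'a \<Rightarrow> real"
  assumes [measurable]: "random_variable borel X" and "integrable M (\<lambda>\<omega>. (X \<omega>)\<^sup>2)"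
  shows "integrable M X"
proof (rule Bochner_Integration.integrable_bound)
  show "integrable M (\<lambda>\<omega>. 1 + (X \<omega>)\<^sup>2)"
    using assms by simp
  have "\<bar>y\<bar> \<le> 1 + y\<^sup>2" for y :: real
    using sum_squares_bound[of "\<bar>y\<bar>" 1] by (simp add: add.commute)
  then show "AE \<omega> in M. norm (X \<omega>) \<le> norm (1 + (X \<omega>)\<^sup>2)"
    by (simp add: abs_of_nonneg)
qed simp

text \<open>Induction on the index set: the new summand is independent of the sum of the others, so
  the cross term is a product of means and vanishes.\<close>

lemma second_moment_sum:
  fixes X :: "'i \<Rightarrow> 'a \<Rightarrow> real"
  assumes "finite I" and "indep_vars (\<lambda>_. borel) X I"
    and "\<And>i. i \<in> I \<Longrightarrow> integrable M (\<lambda>\<omega>. (X i \<omega>)\<^sup>2)"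
    and "\<And>i. i \<in> I \<Longrightarrow> expectation (X i) = 0"
  shows "integrable M (\<lambda>\<omega>. (\<Sum>i\<in>I. X i \<omega>)\<^sup>2)"
    and "expectation (\<lambda>\<omega>. (\<Sum>i\<in>I. X i \<omega>)\<^sup>2) = (\<Sum>i\<in>I. expectation (\<lambda>\<omega>. (X i \<omega>)\<^sup>2))"
proof -
  have "integrable M (\<lambda>\<omega>. (\<Sum>i\<in>I. X i \<omega>)\<^sup>2) \<and>
      expectation (\<lambda>\<omega>. (\<Sum>i\<in>I. X i \<omega>)\<^sup>2) = (\<Sum>i\<in>I. expectation (\<lambda>\<omega>. (X i \<omega>)\<^sup>2))"
    using assms
  proof (induction I)
    case (insert i I)
    have rv [measurable]: "j \<in> insert i I \<Longrightarrow> random_variable borel (X j)" for j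
      using insert.prems(1) unfolding indep_vars_def by blast
    have int: "integrable M (X j)" if "j \<in> insert i I" for j
      by (rule integrable_of_square[OF rv[OF that] insert.prems(2)[OF that]])
    have IH: "integrable M (\<lambda>\<omega>. (\<Sum>i\<in>I. X i \<omega>)\<^sup>2)"
      "expectation (\<lambda>\<omega>. (\<Sum>i\<in>I. X i \<omega>)\<^sup>2) = (\<Sum>i\<in>I. expectation (\<lambda>\<omega>. (X i \<omega>)\<^sup>2))"
      using insert.IH[OF indep_vars_subset[OF insert.prems(1)]] insert.prems by auto
    have ind: "indep_var borel (X i) borel (\<lambda>\<omega>. \<Sum>j\<in>I. X j \<omega>)"
      by (rule indep_vars_sum[OF insert.hyps insert.prems(1)])
    have intS: "integrable M (\<lambda>\<omega>. \<Sum>j\<in>I. X j \<omega>)"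
      using int by (intro Bochner_Integration.integrable_sum) auto
    have ic: "integrable M (\<lambda>\<omega>. X i \<omega> * (\<Sum>j\<in>I. X j \<omega>))"
      using indep_var_integrable[OF ind] int intS by simp
    have ec: "expectation (\<lambda>\<omega>. X i \<omega> * (\<Sum>j\<in>I. X j \<omega>)) = 0"
      using indep_var_lebesgue_integral[OF ind] int intS insert.prems(3) by simp
    have eq: "(\<Sum>j\<in>insert i I. X j \<omega>)\<^sup>2 =
        (X i \<omega>)\<^sup>2 + 2 * (X i \<omega> * (\<Sum>j\<in>I. X j \<omega>)) + (\<Sum>j\<in>I. X j \<omega>)\<^sup>2" for \<omega>
      using insert.hyps by (simp add: power2_sum algebra_simps)
    show ?case
      unfolding eq using ic ec IH insert.prems(2) insert.hyps by simp
  qed simp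
  then show "integrable M (\<lambda>\<omega>. (\<Sum>i\<in>I. X i \<omega>)\<^sup>2)"
    and "expectation (\<lambda>\<omega>. (\<Sum>i\<in>I. X i \<omega>)\<^sup>2) = (\<Sum>i\<in>I. expectation (\<lambda>\<omega>. (X i \<omega>)\<^sup>2))"
    by auto
qed

lemma indep_var_prob_conj:
  assumes "indep_var N X N' Y" and "A \<in> sets N" and "B \<in> sets N'"
  shows "\<P>(\<omega> in M. X \<omega> \<in> A \<and> Y \<omega> \<in> B) = \<P>(\<omega> in M. X \<omega> \<in> A) * \<P>(\<omega> in M. Y \<omega> \<in> B)"
proof -
  have "(\<lambda>\<omega>. (X \<omega>, Y \<omega>)) -` (A \<times> B) \<inter> space M = {\<omega> \<in> space M. X \<omega> \<in> A \<and> Y \<omega> \<in> B}"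
    "X -` A \<inter> space M = {\<omega> \<in> space M. X \<omega> \<in> A}" "Y -` B \<inter> space M = {\<omega> \<in> space M. Y \<omega> \<in> B}"
    by auto
  then show ?thesis
    using indep_varD[OF assms] by simp
qed

lemma indep_vars_pair:
  assumes "indep_vars M' X I" and "i \<in> I" "j \<in> I" "i \<noteq> j"
  shows "indep_var (M' i) (X i) (M' j) (X j)"
proof -
  have "indep_var (PiM {i} M') (\<lambda>\<omega>. restrict (\<lambda>i. X i \<omega>) {i})
      (PiM {j} M') (\<lambda>\<omega>. restrict (\<lambda>i. X i \<omega>) {j})"
    using assms by (intro indep_var_restrict[OF assms(1)]) auto
  from indep_var_compose[OF this, of "\<lambda>f. f i" "M' i" "\<lambda>f. f j" "M' j"]
  show ?thesis
    by (simp add: comp_def)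
qed

end

locale centered_summands = prob_space M for M :: "'a measure" +
  fixes I :: "'i set" and X :: "'i \<Rightarrow> 'a \<Rightarrow> real"
  assumes finite_index: "finite I"
    and indep: "indep_vars (\<lambda>_. borel) X I"
    and square_integrable: "\<And>i. i \<in> I \<Longrightarrow> integrable M (\<lambda>\<omega>. (X i \<omega>)\<^sup>2)"
    and centered: "\<And>i. i \<in> I \<Longrightarrow> expectation (X i) = 0"
begin

definition total_var :: real where
  "total_var = (\<Sum>i\<in>I. expectation (\<lambda>\<omega>. (X i \<omega>)\<^sup>2))"

definition tail_sum :: "real \<Rightarrow> real" where
  "tail_sum y = (\<Sum>i\<in>I. \<P>(\<omega> in M. y \<le> X i \<omega>))"

text \<open>The events that spoil the picture of \<open>X i\<close> as the only large jump, the rest of the sum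
  being smaller than \<open>s\<close>. They do not involve \<open>X i\<close>.\<close>

definition blurred :: "real \<Rightarrow> real \<Rightarrow> 'i \<Rightarrow> 'a \<Rightarrow> bool" where
  "blurred s y i \<omega> \<longleftrightarrow> s \<le> \<bar>\<Sum>j\<in>I - {i}. X j \<omega>\<bar> \<or> (\<exists>j\<in>I - {i}. y \<le> X j \<omega>)"

lemma rv [measurable]: "i \<in> I \<Longrightarrow> random_variable borel (X i)"
  using indep unfolding indep_vars_def by blast

lemma integrable_summand: "i \<in> I \<Longrightarrow> integrable M (X i)"
  by (rule integrable_of_square) (auto intro: square_integrable)

lemma tail_sum_nonneg: "0 \<le> tail_sum y"
  unfolding tail_sum_def by (intro sum_nonneg) simp

lemma blurred_event [measurable]: "i \<in> I \<Longrightarrow> {\<omega> \<in> space M. blurred s y i \<omega>} \<in> events"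
proof -
  assume [measurable]: "i \<in> I"
  have [measurable]: "random_variable borel (\<lambda>\<omega>. \<Sum>j\<in>I - {i}. X j \<omega>)"
    by (intro borel_measurable_sum) (auto simp: rv)
  have "{\<omega> \<in> space M. blurred s y i \<omega>} = {\<omega> \<in> space M. s \<le> \<bar>\<Sum>j\<in>I - {i}. X j \<omega>\<bar>} \<union>
      (\<Union>j\<in>I - {i}. {\<omega> \<in> space M. y \<le> X j \<omega>})"
    unfolding blurred_def by auto
  also have "\<dots> \<in> events"
    using finite_index by (intro sets.Un sets.finite_UN) auto
  finally show ?thesis .
qed

text \<open>\<open>blurred\<close> at \<open>i\<close> depends only on the other summands, so
  independence splits off the tail of \<open>X i\<close>. Chebyshev handles the rest of the sum, the
  union bound a second large summand.\<close>

lemma prob_large_and_blurred: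
  assumes i: "i \<in> I" and s: "0 < s"
  shows "\<P>(\<omega> in M. u \<le> X i \<omega> \<and> blurred s y i \<omega>)
    \<le> \<P>(\<omega> in M. u \<le> X i \<omega>) * (total_var / s\<^sup>2 + tail_sum y)"
proof -
  let ?J = "I - {i}" and ?p = "\<P>(\<omega> in M. u \<le> X i \<omega>)"
  let ?S = "\<lambda>\<omega>. \<Sum>j\<in>?J. X j \<omega>"
  have J: "finite ?J" "i \<notin> ?J" "insert i ?J = I" "?J \<subseteq> I"
    using i finite_index by auto
  note [measurable] = i
  have S [measurable]: "random_variable borel ?S"
    by (intro borel_measurable_sum) (auto simp: rv)
  have indS: "indep_var borel (X i) borel ?S"
    using indep_vars_sum[of ?J i X] J indep by simp
  note m2 = second_moment_sum[OF J(1) indep_vars_subset[OF indep J(4)]]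
  have "prob {\<omega> \<in> space M. s \<le> \<bar>?S \<omega> - expectation ?S\<bar>} \<le> variance ?S / s\<^sup>2"
    using m2(1) square_integrable centered s by (intro Chebyshev_inequality) auto
  moreover have e0: "expectation ?S = 0"
    using integrable_summand centered by (subst Bochner_Integration.integral_sum) auto
  moreover have "expectation (\<lambda>\<omega>. (?S \<omega>)\<^sup>2) \<le> total_var"
    unfolding total_var_def using m2(2) square_integrable centered finite_index
    by (simp add: sum_mono2)
  ultimately have "prob {\<omega> \<in> space M. s \<le> \<bar>?S \<omega>\<bar>} \<le> total_var / s\<^sup>2"
    by simp (smt (verit) divide_right_mono zero_le_power2)
  moreover have "\<P>(\<omega> in M. X i \<omega> \<in> {u..} \<and> ?S \<omega> \<in> {z. s \<le> \<bar>z\<bar>})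
      = \<P>(\<omega> in M. X i \<omega> \<in> {u..}) * \<P>(\<omega> in M. ?S \<omega> \<in> {z. s \<le> \<bar>z\<bar>})"
    by (intro indep_var_prob_conj[OF indS]) measurable
  ultimately have p1: "\<P>(\<omega> in M. u \<le> X i \<omega> \<and> s \<le> \<bar>?S \<omega>\<bar>) \<le> ?p * (total_var / s\<^sup>2)"
    by (simp add: mult_left_mono del: times_divide_eq_right)
  have p2: "\<P>(\<omega> in M. u \<le> X i \<omega> \<and> y \<le> X j \<omega>) = ?p * \<P>(\<omega> in M. y \<le> X j \<omega>)" if "j \<in> ?J" for j
    using indep_var_prob_conj[OF indep_vars_pair[OF indep i, of j], of "{u..}" "{y..}"] that by auto
  have "{\<omega> \<in> space M. u \<le> X i \<omega> \<and> blurred s y i \<omega>} =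
      {\<omega> \<in> space M. u \<le> X i \<omega> \<and> s \<le> \<bar>?S \<omega>\<bar>} \<union>
      (\<Union>j\<in>?J. {\<omega> \<in> space M. u \<le> X i \<omega> \<and> y \<le> X j \<omega>})"
    unfolding blurred_def by auto
  then have "\<P>(\<omega> in M. u \<le> X i \<omega> \<and> blurred s y i \<omega>)
      \<le> \<P>(\<omega> in M. u \<le> X i \<omega> \<and> s \<le> \<bar>?S \<omega>\<bar>) +
        prob (\<Union>j\<in>?J. {\<omega> \<in> space M. u \<le> X i \<omega> \<and> y \<le> X j \<omega>})"
    using J(1) by (simp only:) (intro measure_Un_le sets.finite_UN; auto)
  also have "\<dots> \<le> ?p * (total_var / s\<^sup>2) +
      (\<Sum>j\<in>?J. \<P>(\<omega> in M. u \<le> X i \<omega> \<and> y \<le> X j \<omega>))"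
    using J(1) by (intro add_mono p1 finite_measure_subadditive_finite) auto
  also have "\<dots> = ?p * (total_var / s\<^sup>2) + ?p * (\<Sum>j\<in>?J. \<P>(\<omega> in M. y \<le> X j \<omega>))"
    using p2 by (simp add: sum_distrib_left)
  also have "\<dots> \<le> ?p * (total_var / s\<^sup>2) + ?p * tail_sum y"
    unfolding tail_sum_def using finite_index by (intro add_left_mono mult_left_mono sum_mono2) auto
  finally show ?thesis
    by (simp add: distrib_left)
qed

text \<open>A summand of at least \<open>x + s\<close> with the rest above \<open>- s\<close> gives
  a sum above \<open>x\<close>. Requiring that no other summand reaches \<open>x + s\<close> makes
  these events disjoint, so their probabilities add up.\<close>

lemma prob_sum_ge_lower:
  assumes s: "0 < s"
  shows "tail_sum (x + s) * (1 - total_var / s\<^sup>2 - tail_sum (x + s))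
    \<le> \<P>(\<omega> in M. x \<le> (\<Sum>i\<in>I. X i \<omega>))"
proof -
  let ?u = "x + s"
  define E where "E i = {\<omega> \<in> space M. ?u \<le> X i \<omega> \<and> \<not> blurred s ?u i \<omega>}" for i
  have E [measurable]: "E i \<in> events" if "i \<in> I" for i
    unfolding E_def using that by measurable
  have pE: "\<P>(\<omega> in M. ?u \<le> X i \<omega>) * (1 - total_var / s\<^sup>2 - tail_sum ?u) \<le> prob (E i)"
    if i: "i \<in> I" for i
  proof -
    note [measurable] = i
    have "E i = {\<omega> \<in> space M. ?u \<le> X i \<omega>} - {\<omega> \<in> space M. ?u \<le> X i \<omega> \<and> blurred s ?u i \<omega>}"
      unfolding E_def by auto
    then have "prob (E i) =
        \<P>(\<omega> in M. ?u \<le> X i \<omega>) - \<P>(\<omega> in M. ?u \<le> X i \<omega> \<and> blurred s ?u i \<omega>)"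
      by (simp only:) (subst finite_measure_Diff; auto)
    then show ?thesis
      using prob_large_and_blurred[OF i s, of ?u ?u] by (simp add: algebra_simps)
  qed
  have disj: "disjoint_family_on E I"
    unfolding disjoint_family_on_def E_def blurred_def by auto
  have sub: "(\<Union>i\<in>I. E i) \<subseteq> {\<omega> \<in> space M. x \<le> (\<Sum>i\<in>I. X i \<omega>)}"
  proof safe
    fix i \<omega> assume i: "i \<in> I" and w: "\<omega> \<in> E i"
    then have "?u \<le> X i \<omega>" "\<bar>\<Sum>j\<in>I - {i}. X j \<omega>\<bar> < s"
      unfolding E_def blurred_def by auto
    then show "x \<le> (\<Sum>i\<in>I. X i \<omega>)"
      using sum.remove[OF finite_index i, of "\<lambda>i. X i \<omega>"] by linarith
  qed (auto simp: E_def)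
  have "tail_sum ?u * (1 - total_var / s\<^sup>2 - tail_sum ?u) \<le> (\<Sum>i\<in>I. prob (E i))"
    unfolding tail_sum_def[of ?u] sum_distrib_right
    by (intro sum_mono pE[unfolded tail_sum_def[of ?u]])
  also have "\<dots> = prob (\<Union>i\<in>I. E i)"
    using finite_index disj E by (intro finite_measure_finite_Union[symmetric]) auto
  also have "\<dots> \<le> \<P>(\<omega> in M. x \<le> (\<Sum>i\<in>I. X i \<omega>))"
    using sub by (intro finite_measure_mono) measurable
  finally show ?thesis .
qed

text \<open>Three ways to reach \<open>x\<close>: a summand of at least \<open>x - s\<close>; a
  summand of at least \<open>y\<close> while the others sum to at least \<open>s\<close>; or no
  summand reaching \<open>y\<close>, in which case truncation at \<open>y\<close> leaves the sum
  unchanged.\<close>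

lemma prob_sum_ge_upper:
  assumes s: "0 < s"
  shows "\<P>(\<omega> in M. x \<le> (\<Sum>i\<in>I. X i \<omega>))
    \<le> tail_sum (x - s) + tail_sum y * (total_var / s\<^sup>2 + tail_sum y)
      + \<P>(\<omega> in M. x \<le> (\<Sum>i\<in>I. min (X i \<omega>) y))"
proof -
  let ?A = "\<Union>i\<in>I. {\<omega> \<in> space M. x - s \<le> X i \<omega>}"
  let ?B = "\<Union>i\<in>I. {\<omega> \<in> space M. y \<le> X i \<omega> \<and> blurred s y i \<omega>}"
  let ?C = "{\<omega> \<in> space M. x \<le> (\<Sum>i\<in>I. min (X i \<omega>) y)}"
  have A: "?A \<in> events" and B: "?B \<in> events"
    using finite_index by (auto intro!: sets.finite_UN)
  have C: "?C \<in> events"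
    by measurable
  have sub: "{\<omega> \<in> space M. x \<le> (\<Sum>i\<in>I. X i \<omega>)} \<subseteq> ?A \<union> ?B \<union> ?C"
  proof
    fix \<omega> assume w: "\<omega> \<in> {\<omega> \<in> space M. x \<le> (\<Sum>i\<in>I. X i \<omega>)}"
    show "\<omega> \<in> ?A \<union> ?B \<union> ?C"
    proof (cases "\<exists>i\<in>I. y \<le> X i \<omega>")
      case True
      then obtain i where i: "i \<in> I" "y \<le> X i \<omega>" by blast
      have "x \<le> X i \<omega> + (\<Sum>j\<in>I - {i}. X j \<omega>)"
        using w sum.remove[OF finite_index i(1), of "\<lambda>i. X i \<omega>"] by simp
      then have "x - s \<le> X i \<omega> \<or> blurred s y i \<omega>"
        unfolding blurred_def by linarith
      then show ?thesis using i w by auto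
    next
      case False
      then have "(\<Sum>i\<in>I. min (X i \<omega>) y) = (\<Sum>i\<in>I. X i \<omega>)"
        by (intro sum.cong) auto
      then show ?thesis using w by simp
    qed
  qed
  have "\<P>(\<omega> in M. x \<le> (\<Sum>i\<in>I. X i \<omega>)) \<le> prob (?A \<union> ?B \<union> ?C)"
    using sub A B C by (intro finite_measure_mono) auto
  also have "\<dots> \<le> prob ?A + prob ?B + prob ?C"
    using measure_Un_le[of "?A \<union> ?B" M ?C] measure_Un_le[of ?A M ?B] A B C by auto
  also have "prob ?A \<le> tail_sum (x - s)"
    unfolding tail_sum_def using finite_index
    by (intro finite_measure_subadditive_finite) auto
  also have "prob ?B \<le> (\<Sum>i\<in>I. \<P>(\<omega> in M. y \<le> X i \<omega> \<and> blurred s y i \<omega>))"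
    using finite_index by (intro finite_measure_subadditive_finite) auto
  also have "\<dots> \<le> tail_sum y * (total_var / s\<^sup>2 + tail_sum y)"
    unfolding tail_sum_def[of y] sum_distrib_right
    by (intro sum_mono prob_large_and_blurred[OF _ s, unfolded tail_sum_def])
  finally show ?thesis by simp
qed

end

section \<open>A Fuk-Nagaev inequality\<close>

text \<open>Up to \<open>q\<close> a second-order Taylor bound costs the factor
  \<open>exp q\<close>; beyond \<open>q\<close> the quotient of \<open>exp z\<close> by
  \<open>z powr q\<close> increases, so its value at \<open>w\<close> dominates.\<close>

lemma exp_le_quadratic_plus_power:
  fixes z w q :: real
  assumes "z \<le> w" "0 < w" "1 \<le> q"
  shows "exp z \<le> 1 + z + exp q * z\<^sup>2 / 2 + exp w * (max 0 z / w) powr q"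
proof -
  have p: "0 \<le> exp w * (max 0 z / w) powr q" by simp
  consider "z \<le> 0" | "0 < z" "z \<le> q" | "q < z" by linarith
  then show ?thesis
  proof cases
    case 1
    \<comment> \<open>The product equals \<open>1 - z ^ 3\<close>. With
      \<open>1 - z \<le> exp (- z)\<close> this bounds \<open>exp z\<close> by
      \<open>1 + z + z\<^sup>2\<close>, and \<open>exp q \<ge> 2\<close> makes up for the halved
      quadratic coefficient.\<close>
    have "1 \<le> (1 - z) * (1 + z + z\<^sup>2)"
      using 1 by (simp add: algebra_simps power2_eq_square mult_nonpos_nonneg mult_nonneg_nonpos)
    moreover have "exp z * (1 - z) \<le> exp z * exp (- z)"
      using exp_ge_add_one_self[of "- z"] by (intro mult_left_mono) auto
    ultimately have "exp z * (1 - z) \<le> (1 + z + z\<^sup>2) * (1 - z)"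
      by (simp add: mult_ac flip: exp_add)
    then have "exp z \<le> 1 + z + z\<^sup>2"
      using 1 by simp
    moreover have "2 \<le> exp q"
      using assms(3) exp_ge_add_one_self[of q] by linarith
    then have "z\<^sup>2 * 2 \<le> z\<^sup>2 * exp q"
      by (intro mult_left_mono) auto
    ultimately have "exp z \<le> 1 + z + exp q * z\<^sup>2 / 2"
      by (simp add: mult.commute)
    then show ?thesis
      using p by linarith
  next
    case 2
    obtain s where s: "\<bar>s\<bar> \<le> \<bar>z\<bar>" "exp z = (\<Sum>m<2. z ^ m / fact m) + exp s / fact 2 * z ^ 2"
      using Maclaurin_exp_le[of z 2] by auto
    have "exp s * z\<^sup>2 \<le> exp q * z\<^sup>2"
      using s(1) 2 by (intro mult_right_mono) auto
    then have "exp z \<le> 1 + z + exp q * z\<^sup>2 / 2"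
      using s(2) by (simp add: numeral_2_eq_2)
    then show ?thesis
      using p by linarith
  next
    case 3
    have z: "0 < z" using 3 assms by simp
    \<comment> \<open>The monotonicity beyond \<open>q\<close> in logarithmic form: since
      \<open>w / z \<ge> 1\<close>, the factor \<open>q\<close> may be replaced by the larger
      \<open>z\<close>.\<close>
    have "ln (w / z) \<le> w / z - 1"
      using z assms(2) by (intro ln_le_minus_one) auto
    then have "q * ln (w / z) \<le> q * (w / z - 1)"
      using assms(3) by (intro mult_left_mono) auto
    also have "\<dots> \<le> z * (w / z - 1)"
      using 3 z assms(1) by (intro mult_right_mono) auto
    also have "\<dots> = w - z"
      using z by (simp add: field_simps)
    finally have "z \<le> w + q * ln (z / w)"
      using z assms(2) by (simp add: ln_div algebra_simps)
    then have "exp z \<le> exp (w + q * ln (z / w))"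
      by simp
    also have "\<dots> = exp w * (max 0 z / w) powr q"
      using z assms(2) by (simp add: exp_add powr_def mult.commute)
    finally have "exp z \<le> exp w * (max 0 z / w) powr q" .
    moreover have "0 \<le> 1 + z + exp q * z\<^sup>2 / 2" using z by simp
    ultimately show ?thesis by linarith
  qed
qed

section \<open>Exponential moments of truncated summands\<close>

context centered_summands
begin

text \<open>The pointwise bound is used at \<open>z = l * min a y\<close> and
  \<open>w = l * y\<close>. Every term is then estimated by its untruncated version, so that
  centering removes the linear one.\<close>

lemma expectation_exp_truncated:
  assumes i: "i \<in> I" and "0 < l" "0 < y" "1 \<le> q"
    and m: "integrable M (\<lambda>\<omega>. max 0 (X i \<omega>) powr q)"
  shows "integrable M (\<lambda>\<omega>. exp (l * min (X i \<omega>) y))"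
    and "expectation (\<lambda>\<omega>. exp (l * min (X i \<omega>) y)) \<le>
      1 + exp q * l\<^sup>2 / 2 * expectation (\<lambda>\<omega>. (X i \<omega>)\<^sup>2)
        + exp (l * y) * y powr - q * expectation (\<lambda>\<omega>. max 0 (X i \<omega>) powr q)"
proof -
  note [measurable] = i
  show int: "integrable M (\<lambda>\<omega>. exp (l * min (X i \<omega>) y))"
    using assms by (intro integrable_const_bound[where B = "exp (l * y)"]) auto
  let ?f = "\<lambda>\<omega>. 1 + l * X i \<omega> + exp q * l\<^sup>2 / 2 * (X i \<omega>)\<^sup>2
      + exp (l * y) * y powr - q * max 0 (X i \<omega>) powr q"
  have "exp (l * min a y) \<le> 1 + l * a + exp q * l\<^sup>2 / 2 * a\<^sup>2
      + exp (l * y) * y powr - q * max 0 a powr q" for a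
  proof -
    have "exp (l * min a y) \<le> 1 + l * min a y + exp q * (l * min a y)\<^sup>2 / 2
        + exp (l * y) * (max 0 (l * min a y) / (l * y)) powr q"
      using assms by (intro exp_le_quadratic_plus_power) auto
    moreover have "l * min a y \<le> l * a"
      using assms by (intro mult_left_mono) auto
    moreover have "(min a y)\<^sup>2 \<le> a\<^sup>2"
      using assms by (intro abs_le_square_iff[THEN iffD1]) auto
    then have "exp q * (l * min a y)\<^sup>2 / 2 \<le> exp q * (l\<^sup>2 * a\<^sup>2) / 2"
      by (intro divide_right_mono mult_left_mono) (auto simp: power_mult_distrib mult_left_mono)
    moreover have "max 0 (l * min a y) / (l * y) \<le> max 0 a / y"
      using assms by (auto simp: field_simps max_def min_def mult_nonneg_nonpos)
    then have "(max 0 (l * min a y) / (l * y)) powr q \<le> (max 0 a / y) powr q"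
      using assms by (intro powr_mono2) auto
    then have "exp (l * y) * (max 0 (l * min a y) / (l * y)) powr q
        \<le> exp (l * y) * (y powr - q * max 0 a powr q)"
      using assms by (intro mult_left_mono) (auto simp: powr_divide powr_minus field_simps)
    ultimately have "exp (l * min a y) \<le> 1 + l * a + exp q * (l\<^sup>2 * a\<^sup>2) / 2
        + exp (l * y) * (y powr - q * max 0 a powr q)"
      by linarith
    then show ?thesis by (simp add: mult.assoc)
  qed
  then have "expectation (\<lambda>\<omega>. exp (l * min (X i \<omega>) y)) \<le> expectation ?f"
    using int m i integrable_summand[OF i] square_integrable[OF i] by (intro integral_mono) auto
  also have "\<dots> = 1 + exp q * l\<^sup>2 / 2 * expectation (\<lambda>\<omega>. (X i \<omega>)\<^sup>2)
      + exp (l * y) * y powr - q * expectation (\<lambda>\<omega>. max 0 (X i \<omega>) powr q)"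
    using m i integrable_summand[OF i] square_integrable[OF i] centered[OF i]
    by (simp add: prob_space)
  finally show "expectation (\<lambda>\<omega>. exp (l * min (X i \<omega>) y)) \<le>
      1 + exp q * l\<^sup>2 / 2 * expectation (\<lambda>\<omega>. (X i \<omega>)\<^sup>2)
        + exp (l * y) * y powr - q * expectation (\<lambda>\<omega>. max 0 (X i \<omega>) powr q)" .
qed

text \<open>Exponential Markov inequality: independence factors the moment generating function, and
  \<open>1 + a \<le> exp a\<close> turns the product into the exponential of a sum.\<close>

lemma Chernoff_truncated:
  assumes l: "0 < l" and y: "0 < y" and q: "1 \<le> q"
    and m: "\<And>i. i \<in> I \<Longrightarrow> integrable M (\<lambda>\<omega>. max 0 (X i \<omega>) powr q)"
    and B: "y powr - q * (\<Sum>i\<in>I. expectation (\<lambda>\<omega>. max 0 (X i \<omega>) powr q)) \<le> B"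
  shows "\<P>(\<omega> in M. x \<le> (\<Sum>i\<in>I. min (X i \<omega>) y))
    \<le> exp (- l * x + exp q * l\<^sup>2 / 2 * total_var + exp (l * y) * B)"
proof -
  let ?Y = "\<lambda>i \<omega>. exp (l * min (X i \<omega>) y)"
  let ?m = "\<lambda>i. expectation (\<lambda>\<omega>. max 0 (X i \<omega>) powr q)"
  let ?a = "\<lambda>i. exp q * l\<^sup>2 / 2 * expectation (\<lambda>\<omega>. (X i \<omega>)\<^sup>2) + exp (l * y) * y powr - q * ?m i"
  note mgf = expectation_exp_truncated[OF _ l y q m]
  have ind: "indep_vars (\<lambda>_. borel) ?Y I"
    by (rule indep_vars_compose2[OF indep, where Y = "\<lambda>i a. exp (l * min a y)"]) simp
  have eq: "exp (l * (\<Sum>i\<in>I. min (X i \<omega>) y)) = (\<Prod>i\<in>I. ?Y i \<omega>)" for \<omega>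
    using finite_index by (simp add: sum_distrib_left exp_sum)
  have "\<P>(\<omega> in M. x \<le> (\<Sum>i\<in>I. min (X i \<omega>) y))
      \<le> exp (- l * x) * expectation (\<lambda>\<omega>. exp (l * (\<Sum>i\<in>I. min (X i \<omega>) y)))"
  proof -
    have int: "integrable M (\<lambda>\<omega>. exp (l * (\<Sum>i\<in>I. min (X i \<omega>) y)))"
      unfolding eq by (rule indep_vars_integrable[OF finite_index ind mgf(1)])
    then have "set_integrable M (space M) (\<lambda>\<omega>. exp (l * (\<Sum>i\<in>I. min (X i \<omega>) y)))"
      unfolding set_integrable_def by (rule integrable_mult_indicator[OF sets.top])
    from Chernoff_ineq_ge[OF l this sets.top, of x] show ?thesis
      by (simp only: set_integral_space[OF int])
  qed
  also have "\<dots> = exp (- l * x) * (\<Prod>i\<in>I. expectation (?Y i))"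
    unfolding eq using indep_vars_lebesgue_integral[OF finite_index ind mgf(1)] by simp
  also have "(\<Prod>i\<in>I. expectation (?Y i)) \<le> (\<Prod>i\<in>I. exp (?a i))"
  proof (intro prod_mono conjI)
    fix i assume i: "i \<in> I"
    have "expectation (?Y i) \<le> 1 + ?a i"
      using mgf(2)[OF i i] by simp
    also have "\<dots> \<le> exp (?a i)" by (rule exp_ge_add_one_self)
    finally show "expectation (?Y i) \<le> exp (?a i)" .
  qed simp
  also have "\<dots> = exp (exp q * l\<^sup>2 / 2 * total_var + exp (l * y) * (y powr - q * (\<Sum>i\<in>I. ?m i)))"
    using finite_index unfolding total_var_def
    by (simp add: sum.distrib sum_distrib_left mult.assoc flip: exp_sum)
  also have "\<dots> \<le> exp (exp q * l\<^sup>2 / 2 * total_var + exp (l * y) * B)"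
    using B by simp
  finally show ?thesis
    by (simp add: mult_left_mono algebra_simps flip: exp_add)
qed

text \<open>The optimal \<open>l\<close> is the smaller of \<open>x * exp (- q)\<close>, which produces the Gaussian term,
  and \<open>ln (1 / B) / y\<close>, which makes \<open>exp (l * y) * B = 1\<close>.\<close>

lemma Fuk_Nagaev:
  assumes x: "0 < x" and y: "0 < y" and q: "1 \<le> q"
    and m: "\<And>i. i \<in> I \<Longrightarrow> integrable M (\<lambda>\<omega>. max 0 (X i \<omega>) powr q)"
    and B: "y powr - q * (\<Sum>i\<in>I. expectation (\<lambda>\<omega>. max 0 (X i \<omega>) powr q)) \<le> B"
    and "0 < B" "B < 1" and V: "total_var \<le> 1"
  shows "\<P>(\<omega> in M. x \<le> (\<Sum>i\<in>I. min (X i \<omega>) y))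
    \<le> exp 1 * (exp (- exp (- q) / 2 * x\<^sup>2) + B powr (x / (2 * y)))"
proof -
  define l0 where "l0 = - ln B / y"
  have l0: "0 < l0" and l0y: "exp (l0 * y) * B = 1"
    unfolding l0_def using assms by (auto simp: exp_minus divide_neg_pos)
  define l where "l = min l0 (x * exp (- q))"
  have l: "0 < l" "l \<le> l0" "l \<le> x * exp (- q)"
    using l0 x unfolding l_def by auto
  have lB: "exp (l * y) * B \<le> 1"
  proof -
    have "exp (l * y) * B \<le> exp (l0 * y) * B"
      using l y \<open>0 < B\<close> by (intro mult_right_mono) auto
    then show ?thesis using l0y by simp
  qed
  \<comment> \<open>Because \<open>l \<le> x * exp (- q)\<close>, the quadratic term uses up at most
    half of \<open>l * x\<close>; the jump term is at most 1 and becomes the factor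
    \<open>exp 1\<close>.\<close>
  have "exp q * l\<^sup>2 / 2 * total_var \<le> exp q * l\<^sup>2 / 2 * 1"
    using V by (intro mult_left_mono) auto
  also have "\<dots> = (exp q * l) * l / 2"
    by (simp add: power2_eq_square)
  also have "\<dots> \<le> (exp q * (x * exp (- q))) * l / 2"
    using l by (intro divide_right_mono mult_right_mono mult_left_mono) auto
  also have "\<dots> = x * l / 2"
    by (simp add: exp_minus)
  finally have "- l * x + exp q * l\<^sup>2 / 2 * total_var + exp (l * y) * B \<le> 1 - l * x / 2"
    using lB by (simp add: mult.commute)
  then have "exp (- l * x + exp q * l\<^sup>2 / 2 * total_var + exp (l * y) * B) \<le> exp (1 - l * x / 2)"
    by simp
  also have "\<dots> = exp 1 * exp (- (l * x / 2))"
    by (simp flip: exp_add)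
  also have "exp (- (l * x / 2)) \<le> exp (- exp (- q) / 2 * x\<^sup>2) + B powr (x / (2 * y))"
  proof (cases "l0 \<le> x * exp (- q)")
    case True
    then have "exp (- (l * x / 2)) = B powr (x / (2 * y))"
      using \<open>0 < B\<close> unfolding l_def l0_def powr_def by (simp add: mult.commute)
    then show ?thesis by simp
  next
    case False
    then have "exp (- (l * x / 2)) = exp (- exp (- q) / 2 * x\<^sup>2)"
      unfolding l_def by (simp add: power2_eq_square mult_ac)
    then show ?thesis by simp
  qed
  finally show ?thesis
    using Chernoff_truncated[OF l(1) y q m B, of x] by (auto intro: order_trans)
qed

end

section \<open>Regularly varying tails\<close>

text \<open>\<open>N\<close> plays the role of the law of \<open>\<xi> 0 / \<sigma>\<close>.\<close>

locale regular_tail = prob_space N for N :: "real measure" +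
  fixes t :: real
  assumes sets_N [measurable_cong, simp]: "sets N = sets borel"
    and t_gt_2: "t > 2"
    and square_integrable_N: "integrable N (\<lambda>z. z\<^sup>2)"
    and second_moment_N: "expectation (\<lambda>z. z\<^sup>2) = 1"
    and mean_N: "expectation (\<lambda>z. z) = 0"
    and tail_pos: "\<And>y. 0 < prob {y..}"
    and tail_regular: "\<And>l. 0 < l \<Longrightarrow> ((\<lambda>y. prob {l * y..} / prob {y..}) \<longlongrightarrow> l powr - t) at_top"
begin

abbreviation F :: "real \<Rightarrow> real" where
  "F y \<equiv> prob {y..}"

lemma tail_antimono: "y \<le> y' \<Longrightarrow> F y' \<le> F y"
  by (rule finite_measure_mono) auto

text \<open>Chebyshev with mean 0 and variance 1. The square matches the normalisation of the
  weights when such bounds are summed.\<close>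

lemma tail_le_inverse_square:
  assumes "0 < y"
  shows "F y \<le> 1 / y\<^sup>2"
proof -
  have "space N = UNIV"
    using sets_eq_imp_space_eq[OF sets_N] by simp
  have "F y \<le> prob {z \<in> space N. y \<le> \<bar>z - expectation (\<lambda>z. z)\<bar>}"
    using \<open>space N = UNIV\<close> by (intro finite_measure_mono) (auto simp: mean_N)
  also have "\<dots> \<le> variance (\<lambda>z. z) / y\<^sup>2"
    using assms square_integrable_N by (intro Chebyshev_inequality) auto
  finally show ?thesis
    by (simp add: mean_N second_moment_N)
qed

text \<open>One half of Potter's bound. The ratio \<open>F (2 * y) / F y\<close> tends to
  \<open>2 powr - t\<close>, which exceeds \<open>2 powr - T\<close>; iterated doubling gives the
  bound at dyadic multiples of \<open>y0\<close>, and monotonicity of the tail fills the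
  gaps.\<close>

lemma tail_ge_powr:
  assumes T: "t < T"
  obtains a y0 where "0 < a" "0 < y0" "\<And>y. y0 \<le> y \<Longrightarrow> a * y powr - T \<le> F y"
proof -
  have "eventually (\<lambda>y. 2 powr - T < F (2 * y) / F y) at_top"
    using T by (intro order_tendstoD(1)[OF tail_regular]) auto
  then obtain y1 where y1: "\<And>y. y1 \<le> y \<Longrightarrow> 2 powr - T < F (2 * y) / F y"
    unfolding eventually_at_top_linorder by blast
  define y0 where "y0 = max 1 y1"
  have y0: "0 < y0" by (simp add: y0_def)
  have step: "2 powr - T * F y \<le> F (2 * y)" if "y0 \<le> y" for y
    using y1[of y] that tail_pos[of y] unfolding y0_def by (simp add: field_simps)
  have iter: "F y0 * (2 ^ n) powr - T \<le> F (2 ^ n * y0)" for n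
  proof (induction n)
    case (Suc n)
    have "F y0 * (2 ^ Suc n) powr - T = 2 powr - T * (F y0 * (2 ^ n) powr - T)"
      by (simp add: powr_mult)
    also have "\<dots> \<le> 2 powr - T * F (2 ^ n * y0)"
      using Suc by (intro mult_left_mono) auto
    also have "\<dots> \<le> F (2 * (2 ^ n * y0))"
      by (rule step) (use y0 in simp)
    finally show ?case by (simp add: mult.assoc)
  qed simp
  show ?thesis
  proof
    \<comment> \<open>The 2 in the constant pays for rounding \<open>y / y0\<close> up to a power of
      two, which at most doubles it.\<close>
    show "0 < F y0 * (2 / y0) powr - T" "0 < y0"
      using tail_pos[of y0] by (auto simp: y0_def)
    fix y assume y: "y0 \<le> y"
    define n where "n = nat \<lceil>log 2 (y / y0)\<rceil>"
    have "0 < y0" "1 \<le> y / y0" using y by (auto simp: y0_def field_simps)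
    then have "0 \<le> log 2 (y / y0)" by simp
    then have n: "log 2 (y / y0) \<le> real n" "real n \<le> log 2 (y / y0) + 1"
      unfolding n_def by linarith+
    have "y / y0 = 2 powr log 2 (y / y0)"
      using \<open>1 \<le> y / y0\<close> by simp
    also have "\<dots> \<le> 2 ^ n"
      using n(1) by (simp flip: powr_realpow)
    finally have 1: "y \<le> 2 ^ n * y0"
      using \<open>0 < y0\<close> by (simp add: field_simps)
    have "(2::real) ^ n = 2 powr real n"
      by (simp add: powr_realpow)
    also have "\<dots> \<le> 2 powr (log 2 (y / y0) + 1)"
      using n(2) by simp
    also have "\<dots> = 2 * (y / y0)"
      using \<open>1 \<le> y / y0\<close> by (simp add: powr_add)
    finally have 2: "2 ^ n \<le> 2 * (y / y0)" .
    have "T > 0" using T t_gt_2 by simp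
    have "F y0 * (2 / y0) powr - T * y powr - T = F y0 * (2 * (y / y0)) powr - T"
      using y \<open>0 < y0\<close> by (simp flip: powr_mult)
    also have "\<dots> \<le> F y0 * (2 ^ n) powr - T"
      using 2 \<open>T > 0\<close> by (intro mult_left_mono powr_mono2') auto
    also have "\<dots> \<le> F y"
      using iter[of n] tail_antimono[OF 1] by simp
    finally show "F y0 * (2 / y0) powr - T * y powr - T \<le> F y" .
  qed
qed

text \<open>For \<open>p\<close> between \<open>q\<close> and \<open>t\<close>, doubling a large
  argument shrinks the tail by at least the factor \<open>2 powr - p\<close>, while the power grows
  by \<open>2 powr q\<close>. The dyadic blocks thus contribute a convergent geometric
  series.\<close>

lemma integrable_positive_part_powr:
  assumes q: "0 < q" "q < t"
  shows "integrable N (\<lambda>z. max 0 z powr q)"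
proof -
  define p where "p = (q + t) / 2"
  have p: "q < p" "p < t" using q by (auto simp: p_def)
  have "eventually (\<lambda>y. F (2 * y) / F y < 2 powr - p) at_top"
    using p by (intro order_tendstoD(2)[OF tail_regular]) auto
  then obtain y1 where y1: "\<And>y. y1 \<le> y \<Longrightarrow> F (2 * y) / F y < 2 powr - p"
    unfolding eventually_at_top_linorder by blast
  define y0 where "y0 = max 1 y1"
  have y0: "0 < y0" by (simp add: y0_def)
  have step: "F (2 * y) \<le> 2 powr - p * F y" if "y0 \<le> y" for y
    using y1[of y] that tail_pos[of y] unfolding y0_def by (simp add: field_simps)
  have iter: "F (2 ^ n * y0) \<le> (2 powr - p) ^ n" for n
  proof (induction n)
    case (Suc n)
    have "F (2 * (2 ^ n * y0)) \<le> 2 powr - p * F (2 ^ n * y0)"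
      by (rule step) (use y0 in simp)
    also have "\<dots> \<le> 2 powr - p * (2 powr - p) ^ n"
      using Suc by (intro mult_left_mono) auto
    finally show ?case by (simp add: mult.assoc)
  qed simp
  \<comment> \<open>The height of \<open>f n\<close> is \<open>(2 ^ (n + 1) * y0) powr q\<close>,
    the supremum of the power on the block from \<open>2 ^ n * y0\<close> to twice that. Taking a
    half-line instead of the block makes the integral a tail value.\<close>
  define f where "f n z = (2 * y0) powr q * (2 powr q) ^ n * indicator {2 ^ n * y0..} z" for n and z :: real
  have f_nonneg: "0 \<le> f n z" for n z
    by (simp add: f_def)
  have f_int: "integrable N (f n)" for n
    unfolding f_def by (intro integrable_mult_right integrable_real_indicator) (auto simp: emeasure_eq_measure)
  have "2 powr q * 2 powr - p < (1::real)"
    using p powr_less_mono[of "q - p" 0 2] by (simp flip: powr_add)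
  then have "summable (\<lambda>n. (2 powr q * 2 powr - p :: real) ^ n)"
    by (intro summable_geometric) simp
  then have s: "summable (\<lambda>n. (2 * y0) powr q * (2 powr q * 2 powr - p) ^ n)"
    by (rule summable_mult)
  have sum_int: "summable (\<lambda>n. \<integral>z. norm (f n z) \<partial>N)"
  proof (rule summable_comparison_test[OF _ s], intro exI allI impI)
    fix n :: nat
    have "(\<integral>z. norm (f n z) \<partial>N) = (2 * y0) powr q * (2 powr q) ^ n * F (2 ^ n * y0)"
      using f_nonneg by (simp add: f_def)
    also have "\<dots> \<le> (2 * y0) powr q * (2 powr q) ^ n * (2 powr - p) ^ n"
      using iter by (intro mult_left_mono) auto
    finally show "norm (\<integral>z. norm (f n z) \<partial>N) \<le> (2 * y0) powr q * (2 powr q * 2 powr - p) ^ n"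
      by (simp add: power_mult_distrib mult_ac)
  qed
  have f_sum: "summable (\<lambda>n. f n z)" for z
  proof -
    obtain m where m: "z / y0 < 2 ^ m"
      using real_arch_pow[of 2 "z / y0"] by auto
    have "f n z = 0" if "n \<notin> {..<m}" for n
    proof -
      have "z / y0 < 2 ^ n"
        using that by (intro less_le_trans[OF m]) simp
      then show ?thesis
        using y0 by (simp add: f_def field_simps)
    qed
    then show ?thesis
      by (intro summable_finite[of "{..<m}"]) auto
  qed
  have int: "integrable N (\<lambda>z. y0 powr q + (\<Sum>n. f n z))"
    using f_int sum_int f_sum f_nonneg
    by (intro Bochner_Integration.integrable_add integrable_suminf) auto
  have "max 0 z powr q \<le> y0 powr q + (\<Sum>n. f n z)" for z
  proof (cases "z \<le> y0")
    case True
    then have "max 0 z powr q \<le> y0 powr q"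
      using y0 q by (intro powr_mono2) auto
    then show ?thesis
      using suminf_nonneg[OF f_sum f_nonneg, of z] by linarith
  next
    case False
    \<comment> \<open>\<open>n\<close> is the index of the dyadic block that contains
      \<open>z\<close>; the single term \<open>f n z\<close> already dominates the power.\<close>
    define n where "n = nat \<lfloor>log 2 (z / y0)\<rfloor>"
    have z: "1 \<le> z / y0" "0 < z" using False y0 by auto
    then have "0 \<le> log 2 (z / y0)" by simp
    then have n: "real n \<le> log 2 (z / y0)" "log 2 (z / y0) \<le> real n + 1"
      unfolding n_def by linarith+
    have "(2::real) ^ n = 2 powr real n"
      by (simp add: powr_realpow)
    also have "\<dots> \<le> 2 powr log 2 (z / y0)"
      using n by simp
    also have zz: "\<dots> = z / y0"
      using z by simp
    finally have "2 ^ n * y0 \<le> z"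
      using y0 by (simp add: field_simps)
    then have fn: "f n z = (2 * y0) powr q * (2 powr q) ^ n"
      by (simp add: f_def)
    have "2 powr log 2 (z / y0) \<le> 2 powr (real n + 1)"
      using n(2) by simp
    then have "z / y0 \<le> 2 powr (real n + 1)"
      by (simp only: zz)
    also have "\<dots> = 2 * 2 ^ n"
      by (simp add: powr_add powr_realpow)
    finally have "z \<le> (2 * y0) * 2 ^ n"
      using y0 by (simp add: field_simps)
    then have "z powr q \<le> ((2 * y0) * 2 ^ n) powr q"
      using z q by (intro powr_mono2) auto
    also have "\<dots> = f n z"
      using y0 unfolding fn by (simp add: powr_mult powr_power powr_powr mult.commute flip: powr_realpow)
    also have "\<dots> \<le> (\<Sum>n. f n z)"
      using sum_le_suminf[OF f_sum[of z], of "{n}"] f_nonneg by simp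
    finally show ?thesis
      using z by (simp add: max_def add_increasing)
  qed
  then show ?thesis
    by (intro Bochner_Integration.integrable_bound[OF int])
      (auto intro!: AE_I2 simp: abs_of_nonneg suminf_nonneg[OF f_sum f_nonneg])
qed

end

section \<open>Weighted sums with negligible weights\<close>

text \<open>The normalised setting: the total variance is 1, so \<open>x n\<close> itself is the
  threshold, and \<open>D\<close> becomes the sum of \<open>b n i powr t\<close>.\<close>

locale weighted_array = prob_space M + tail: regular_tail N t
  for M :: "'a measure" and N :: "real measure" and t :: real +
  fixes Z :: "'i \<Rightarrow> 'a \<Rightarrow> real" and I :: "nat \<Rightarrow> 'i set" and b :: "nat \<Rightarrow> 'i \<Rightarrow> real"
    and x :: "nat \<Rightarrow> real" and C :: real
  assumes indep_Z: "indep_vars (\<lambda>_. borel) Z UNIV"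
    and distr_Z: "\<And>i. distr M borel (Z i) = N"
    and finite_I: "\<And>n. finite (I n)" and I_nonempty: "\<And>n. I n \<noteq> {}"
    and b_pos: "\<And>n i. i \<in> I n \<Longrightarrow> 0 < b n i"
    and b_normed: "\<And>n. (\<Sum>i\<in>I n. (b n i)\<^sup>2) = 1"
    and b_negligible: "(\<lambda>n. Max (b n ` I n)) \<longlonglongrightarrow> 0"
    and C_pos: "0 < C" and C_gt: "4 * exp t < C\<^sup>2"
    and x_ge: "\<And>n. C * sqrt (ln (inverse (\<Sum>i\<in>I n. b n i powr t))) \<le> x n"
begin

lemma Z_measurable [measurable]: "random_variable borel (Z i)"
  using indep_Z unfolding indep_vars_def by auto

lemma prob_Z_ge: "\<P>(\<omega> in M. y \<le> Z i \<omega>) = tail.F y"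
  unfolding distr_Z[of i, symmetric] by (subst measure_distr) (auto intro!: arg_cong[where f = prob])

lemma integrable_Z:
  assumes [measurable]: "f \<in> borel_measurable borel" and "integrable N f"
  shows "integrable M (\<lambda>\<omega>. f (Z i \<omega>) :: real)"
  using assms(2) unfolding distr_Z[of i, symmetric] by (simp add: integrable_distr_eq)

lemma expectation_Z:
  fixes f :: "real \<Rightarrow> real"
  assumes [measurable]: "f \<in> borel_measurable borel"
  shows "expectation (\<lambda>\<omega>. f (Z i \<omega>)) = (\<integral>z. f z \<partial>N)"
  unfolding distr_Z[of i, symmetric] by (simp add: integral_distr)

section \<open>Normalised weights and their power sums\<close>

definition bmax :: "nat \<Rightarrow> real" where
  "bmax n = Max (b n ` I n)"

definition G :: "real \<Rightarrow> nat \<Rightarrow> real" where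
  "G l n = (\<Sum>i\<in>I n. tail.F (l * (x n / b n i)))"

lemma b_le_bmax: "i \<in> I n \<Longrightarrow> b n i \<le> bmax n"
  unfolding bmax_def using finite_I by (intro Max_ge) auto

lemma bmax_attained: obtains i where "i \<in> I n" "b n i = bmax n"
  using Max_in[of "b n ` I n"] finite_I I_nonempty unfolding bmax_def by (metis finite_imageI image_iff image_is_empty)

lemma bmax_pos: "0 < bmax n"
  using bmax_attained b_pos by metis

lemma summands: "centered_summands M (I n) (\<lambda>i \<omega>. b n i * Z i \<omega>)"
proof
  show "indep_vars (\<lambda>_. borel) (\<lambda>i \<omega>. b n i * Z i \<omega>) (I n)"
    by (rule indep_vars_compose2[OF indep_vars_subset[OF indep_Z], where Y = "\<lambda>i z. b n i * z"]) auto
  show "integrable M (\<lambda>\<omega>. (b n i * Z i \<omega>)\<^sup>2)" for i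
    using integrable_Z[OF _ tail.square_integrable_N] by (simp add: power_mult_distrib)
  show "expectation (\<lambda>\<omega>. b n i * Z i \<omega>) = 0" for i
    using expectation_Z[of "\<lambda>z. z" i] by (simp add: tail.mean_N)
qed (rule finite_I)

lemma total_var_eq: "centered_summands.total_var M (I n) (\<lambda>i \<omega>. b n i * Z i \<omega>) = 1"
  unfolding centered_summands.total_var_def[OF summands]
  using expectation_Z[of "\<lambda>z. z\<^sup>2"] b_normed[of n] by (simp add: power_mult_distrib tail.second_moment_N)

lemma tail_sum_eq:
  "centered_summands.tail_sum M (I n) (\<lambda>i \<omega>. b n i * Z i \<omega>) (l * x n) = G l n"
proof -
  have "\<P>(\<omega> in M. l * x n \<le> b n i * Z i \<omega>) = tail.F (l * (x n / b n i))" if "i \<in> I n" for i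
  proof -
    have "l * x n \<le> b n i * Z i \<omega> \<longleftrightarrow> l * (x n / b n i) \<le> Z i \<omega>" for \<omega>
      using b_pos[OF that] by (simp add: field_simps)
    then show ?thesis by (simp add: prob_Z_ge)
  qed
  then show ?thesis
    unfolding centered_summands.tail_sum_def[OF summands] G_def by simp
qed

text \<open>Both upper bounds use that the squared weights sum to 1: the first after extracting the
  largest weight, the second in Cauchy-Schwarz for
  \<open>b n i * b n i powr (t - 1)\<close>.\<close>

lemma powr_sum_bounds:
  shows "0 < (\<Sum>i\<in>I n. b n i powr t)"
    and "(\<Sum>i\<in>I n. b n i powr t) \<le> bmax n powr (t - 2)"
    and "(\<Sum>i\<in>I n. b n i powr t)\<^sup>2 \<le> (\<Sum>i\<in>I n. b n i powr (2 * t - 2))"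
proof -
  show "0 < (\<Sum>i\<in>I n. b n i powr t)"
    using b_pos finite_I I_nonempty by (intro sum_pos) (auto simp: less_le)
  have "b n i powr t \<le> bmax n powr (t - 2) * (b n i)\<^sup>2" if "i \<in> I n" for i
  proof -
    have "b n i powr t = b n i powr (t - 2) * (b n i)\<^sup>2"
      using b_pos[OF that] by (simp add: powr_diff)
    also have "\<dots> \<le> bmax n powr (t - 2) * (b n i)\<^sup>2"
      using b_pos[OF that] b_le_bmax[OF that] tail.t_gt_2
      by (intro mult_right_mono powr_mono2) auto
    finally show ?thesis .
  qed
  then have "(\<Sum>i\<in>I n. b n i powr t) \<le> (\<Sum>i\<in>I n. bmax n powr (t - 2) * (b n i)\<^sup>2)"
    by (rule sum_mono)
  then show "(\<Sum>i\<in>I n. b n i powr t) \<le> bmax n powr (t - 2)"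
    by (simp add: b_normed flip: sum_distrib_left)
  have 1: "b n i powr t = b n i * b n i powr (t - 1)"
    and 2: "b n i powr (2 * t - 2) = (b n i powr (t - 1))\<^sup>2" if "i \<in> I n" for i
    using b_pos[OF that] by (simp_all add: powr_diff powr_power power2_eq_square flip: powr_add)
  have "(\<Sum>i\<in>I n. b n i powr t)\<^sup>2 = (\<Sum>i\<in>I n. b n i * b n i powr (t - 1))\<^sup>2"
    using 1 by simp
  also have "\<dots> \<le> (\<Sum>i\<in>I n. (b n i)\<^sup>2) * (\<Sum>i\<in>I n. (b n i powr (t - 1))\<^sup>2)"
    by (rule Cauchy_Schwarz_ineq_sum)
  also have "\<dots> = (\<Sum>i\<in>I n. b n i powr (2 * t - 2))"
    using 2 by (simp add: b_normed)
  finally show "(\<Sum>i\<in>I n. b n i powr t)\<^sup>2 \<le> (\<Sum>i\<in>I n. b n i powr (2 * t - 2))" .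
qed

text \<open>Negligible weights force the sum of \<open>b n i powr t\<close> to 0 through its bound
  \<open>bmax n powr (t - 2)\<close>, so the lower bound on \<open>x n\<close> diverges.\<close>

lemma x_tendsto: "filterlim x at_top sequentially"
proof -
  let ?D = "\<lambda>n. \<Sum>i\<in>I n. b n i powr t"
  have "(\<lambda>n. bmax n powr (t - 2)) \<longlonglongrightarrow> 0"
    using b_negligible tail.t_gt_2 bmax_pos unfolding bmax_def[symmetric]
    by (intro tendsto_zero_powrI[where b = "t - 2"]) (auto simp: less_imp_le)
  then have "?D \<longlonglongrightarrow> 0"
    by (rule Lim_null_comparison[rotated])
      (use powr_sum_bounds in \<open>auto intro!: always_eventually simp: less_imp_le\<close>)
  then have "filterlim ?D (at_right 0) sequentially"
    by (auto simp: filterlim_at powr_sum_bounds(1) less_imp_neq[OF powr_sum_bounds(1), symmetric])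
  then have "filterlim (\<lambda>n. ln (inverse (?D n))) at_top sequentially"
    by (intro filterlim_compose[OF ln_at_top] filterlim_compose[OF filterlim_inverse_at_top_right])
  then have "filterlim (\<lambda>n. C * sqrt (ln (inverse (?D n)))) at_top sequentially"
    using C_pos
    by (intro filterlim_tendsto_pos_mult_at_top[OF tendsto_const] filterlim_compose[OF sqrt_at_top])
  then show ?thesis
    by (rule filterlim_at_top_mono) (use x_ge in \<open>auto intro!: always_eventually\<close>)
qed

section \<open>Asymptotics of the tail sums \<open>G\<close>\<close>

lemma eventually_x_ge: "eventually (\<lambda>n. c \<le> x n) sequentially"
  using x_tendsto by (simp add: filterlim_at_top)

lemma bmax_over_x: "(\<lambda>n. bmax n / x n) \<longlonglongrightarrow> 0"
proof -
  have "(\<lambda>n. bmax n * inverse (x n)) \<longlonglongrightarrow> 0 * 0"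
    using b_negligible unfolding bmax_def[symmetric]
    by (intro tendsto_mult tendsto_inverse_0_at_top[OF x_tendsto])
  then show ?thesis by (simp add: divide_inverse)
qed

text \<open>The smallest argument is \<open>x n / bmax n\<close>, which diverges. This uniformity in
  \<open>i\<close> lets the asymptotics of \<open>F\<close> be used in all terms of \<open>G\<close>
  at once.\<close>

lemma eventually_arguments_ge:
  "eventually (\<lambda>n. \<forall>i\<in>I n. y \<le> x n / b n i) sequentially"
proof -
  have "eventually (\<lambda>n. bmax n / x n < 1 / max 1 y) sequentially"
    by (rule order_tendstoD(2)[OF bmax_over_x]) simp
  then show ?thesis
    using eventually_x_ge[of 1]
  proof eventually_elim
    case (elim n)
    show ?case
    proof
      fix i assume i: "i \<in> I n"
      have "y * b n i \<le> max 1 y * bmax n"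
        using b_pos[OF i] b_le_bmax[OF i] by (intro mult_mono) auto
      also have "\<dots> \<le> x n"
        using elim by (simp add: field_simps)
      finally show "y \<le> x n / b n i"
        using b_pos[OF i] by (simp add: field_simps)
    qed
  qed
qed

lemma G_pos: "0 < G l n"
  unfolding G_def using tail.tail_pos finite_I I_nonempty by (intro sum_pos) auto

text \<open>A relative error bound valid for every term passes to the sum, as all terms are
  positive.\<close>

lemma G_ratio:
  assumes "0 < l"
  shows "(\<lambda>n. G l n / G 1 n) \<longlonglongrightarrow> l powr - t"
proof (rule tendstoI)
  have abs_eq: "\<bar>f - c * g\<bar> = \<bar>f / g - c\<bar> * g" if "0 < g" for f g c :: real
  proof -
    have "f - c * g = (f / g - c) * g"
      using that by (simp add: left_diff_distrib)
    then show ?thesis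
      using that by (simp add: abs_mult)
  qed
  fix e :: real assume "0 < e"
  then have "eventually (\<lambda>y. dist (tail.F (l * y) / tail.F y) (l powr - t) < e / 2) at_top"
    using tail.tail_regular[OF assms] by (intro tendstoD) auto
  then obtain y1 where y1: "\<And>y. y1 \<le> y \<Longrightarrow> dist (tail.F (l * y) / tail.F y) (l powr - t) < e / 2"
    unfolding eventually_at_top_linorder by blast
  have bound: "\<bar>tail.F (l * y) - l powr - t * tail.F y\<bar> \<le> e / 2 * tail.F y" if "y1 \<le> y" for y
  proof -
    have "\<bar>tail.F (l * y) - l powr - t * tail.F y\<bar> = \<bar>tail.F (l * y) / tail.F y - l powr - t\<bar> * tail.F y"
      by (rule abs_eq[OF tail.tail_pos])
    also have "\<dots> \<le> e / 2 * tail.F y"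
      using y1[OF that] by (intro mult_right_mono) (auto simp: dist_real_def)
    finally show ?thesis .
  qed
  show "eventually (\<lambda>n. dist (G l n / G 1 n) (l powr - t) < e) sequentially"
    using eventually_arguments_ge[of y1]
  proof eventually_elim
    case (elim n)
    have "\<bar>G l n - l powr - t * G 1 n\<bar> =
        \<bar>\<Sum>i\<in>I n. tail.F (l * (x n / b n i)) - l powr - t * tail.F (x n / b n i)\<bar>"
      unfolding G_def by (simp add: sum_subtractf sum_distrib_left)
    also have "\<dots> \<le> (\<Sum>i\<in>I n. e / 2 * tail.F (x n / b n i))"
      using elim by (intro order_trans[OF sum_abs] sum_mono bound) auto
    also have "\<dots> = e / 2 * G 1 n"
      unfolding G_def by (simp add: sum_distrib_left)
    also have "\<dots> < e * G 1 n"
      using \<open>0 < e\<close> G_pos[of 1 n] by simp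
    finally have "\<bar>G l n / G 1 n - l powr - t\<bar> * G 1 n < e * G 1 n"
      by (simp only: abs_eq[OF G_pos])
    then show ?case
      using G_pos[of 1 n] by (simp add: dist_real_def)
  qed
qed

text \<open>The Chebyshev bounds of the terms are
  \<open>(b n i)\<^sup>2 / (l * x n)\<^sup>2\<close>, and the squared weights sum to 1.\<close>

lemma G_tendsto_0:
  assumes "0 < l"
  shows "G l \<longlonglongrightarrow> 0"
proof (rule Lim_null_comparison)
  show "eventually (\<lambda>n. norm (G l n) \<le> inverse ((l * x n)\<^sup>2)) sequentially"
    using eventually_x_ge[of 1]
  proof eventually_elim
    case (elim n)
    have "G l n \<le> (\<Sum>i\<in>I n. 1 / (l * (x n / b n i))\<^sup>2)"
      unfolding G_def using assms elim b_pos
      by (intro sum_mono tail.tail_le_inverse_square) simp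
    also have "\<dots> = (\<Sum>i\<in>I n. (b n i)\<^sup>2) / (l * x n)\<^sup>2"
      unfolding sum_divide_distrib by (intro sum.cong) (auto simp: power_mult_distrib power_divide)
    finally show ?case
      using G_pos[of l n] by (simp add: b_normed divide_inverse)
  qed
  have "filterlim (\<lambda>n. (l * x n)\<^sup>2) at_top sequentially"
    using assms x_tendsto
    by (intro filterlim_pow_at_top filterlim_tendsto_pos_mult_at_top[OF tendsto_const]) auto
  then show "(\<lambda>n. inverse ((l * x n)\<^sup>2)) \<longlonglongrightarrow> 0"
    by (rule tendsto_inverse_0_at_top)
qed

text \<open>The exponent \<open>2 * t - 2\<close> exceeds \<open>t\<close>, as Potter's bound requires, and by Cauchy-Schwarz
  the corresponding power sum dominates the square of \<open>D\<close>.\<close>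

lemma G_ge:
  obtains a where "0 < a"
    and "eventually (\<lambda>n. a * (bmax n / x n) powr (2 * t - 2) \<le> G 1 n) sequentially"
    and "eventually (\<lambda>n. a * (x n powr - (2 * t - 2) * exp (- 2 * (x n)\<^sup>2 / C\<^sup>2)) \<le> G 1 n) sequentially"
proof -
  define T where "T = 2 * t - 2"
  have "t < T" "0 < T" using tail.t_gt_2 by (auto simp: T_def)
  from tail.tail_ge_powr[OF this(1)] obtain a y0
    where a: "0 < a" "0 < y0" "\<And>y. y0 \<le> y \<Longrightarrow> a * y powr - T \<le> tail.F y" by metis
  have ev: "eventually (\<lambda>n. (\<forall>i\<in>I n. a * (b n i / x n) powr T \<le> tail.F (x n / b n i)) \<and> 1 \<le> x n) sequentially"
    using eventually_arguments_ge[of y0] eventually_x_ge[of 1]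
  proof eventually_elim
    case (elim n)
    have "(x n / b n i) powr - T = (b n i / x n) powr T" if "i \<in> I n" for i
      using b_pos[OF that] elim by (simp add: powr_minus powr_divide)
    with elim a(3) show ?case by metis
  qed
  show thesis
  proof (rule that[OF a(1)]; unfold T_def[symmetric])
    show "eventually (\<lambda>n. a * (bmax n / x n) powr T \<le> G 1 n) sequentially"
      using ev
    proof eventually_elim
      case (elim n)
      obtain i where i: "i \<in> I n" "b n i = bmax n" by (rule bmax_attained)
      have "a * (bmax n / x n) powr T \<le> tail.F (x n / b n i)"
        using elim i by metis
      also have "\<dots> \<le> G 1 n"
        using member_le_sum[OF i(1), of "\<lambda>i. tail.F (x n / b n i)"] finite_I i(2)
        by (simp add: G_def)
      finally show ?case .
    qed
    show "eventually (\<lambda>n. a * (x n powr - T * exp (- 2 * (x n)\<^sup>2 / C\<^sup>2)) \<le> G 1 n) sequentially"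
      using ev
    proof eventually_elim
      case (elim n)
      let ?D = "\<Sum>i\<in>I n. b n i powr t"
      have D: "0 < ?D" by (rule powr_sum_bounds)
      \<comment> \<open>Solving the growth condition for \<open>?D\<close> gives
        \<open>?D \<ge> exp (- (x n / C)\<^sup>2)\<close>.\<close>
      have "C * sqrt (ln (inverse ?D)) \<le> x n" by (rule x_ge)
      then have "sqrt (ln (inverse ?D)) \<le> x n / C"
        using C_pos by (simp add: field_simps)
      then have "ln (inverse ?D) \<le> (x n / C)\<^sup>2"
        by (rule sqrt_le_D)
      then have "- (x n / C)\<^sup>2 \<le> ln ?D"
        using D by (simp add: ln_inverse)
      then have "exp (- (x n / C)\<^sup>2) \<le> ?D"
        using D by (simp add: ln_ge_iff)
      then have "(exp (- (x n / C)\<^sup>2))\<^sup>2 \<le> ?D\<^sup>2"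
        by (intro power_mono) auto
      then have "exp (- 2 * (x n)\<^sup>2 / C\<^sup>2) \<le> ?D\<^sup>2"
        by (simp add: power_divide flip: exp_double)
      also have "\<dots> \<le> (\<Sum>i\<in>I n. b n i powr T)"
        unfolding T_def by (rule powr_sum_bounds)
      finally have "x n powr - T * exp (- 2 * (x n)\<^sup>2 / C\<^sup>2) \<le> x n powr - T * (\<Sum>i\<in>I n. b n i powr T)"
        by (intro mult_left_mono) auto
      also have "\<dots> = (\<Sum>i\<in>I n. (b n i / x n) powr T)"
        using elim b_pos unfolding sum_distrib_left
        by (intro sum.cong) (auto simp: powr_divide powr_minus field_simps less_imp_le)
      finally have "a * (x n powr - T * exp (- 2 * (x n)\<^sup>2 / C\<^sup>2)) \<le> a * (\<Sum>i\<in>I n. (b n i / x n) powr T)"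
        using a by (intro mult_left_mono) auto
      also have "\<dots> \<le> G 1 n"
        unfolding G_def sum_distrib_left using elim by (intro sum_mono) simp
      finally show ?case .
    qed
  qed
qed

section \<open>The sum of truncated summands\<close>

text \<open>Fuk-Nagaev at truncation level \<open>e * x n\<close>, where the exponent
  \<open>x / (2 * y)\<close> becomes the constant \<open>1 / (2 * e)\<close>. The base of the power
  tends to 0, so it is eventually below 1, as that inequality requires.\<close>

lemma remainder_bound:
  assumes q: "2 < q" "q < t" and e: "0 < e"
  obtains K where "0 < K" and "eventually (\<lambda>n. \<P>(\<omega> in M. x n \<le> (\<Sum>i\<in>I n. min (b n i * Z i \<omega>) (e * x n)))
    \<le> exp 1 * (exp (- exp (- q) / 2 * (x n)\<^sup>2) + (K * (bmax n / x n) powr (q - 2)) powr (1 / (2 * e)))) sequentially"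
proof -
  define m where "m = (\<integral>z. max 0 z powr q \<partial>N)"
  have "0 \<le> m" unfolding m_def by simp
  \<comment> \<open>The added 1 secures \<open>K > 0\<close>, since Fuk-Nagaev asks for a strictly
    positive \<open>B\<close>.\<close>
  define K where "K = e powr - q * m + 1"
  have K: "0 < K" "e powr - q * m \<le> K"
    using \<open>0 \<le> m\<close> unfolding K_def by (auto intro!: add_nonneg_pos)
  have "(\<lambda>n. K * (bmax n / x n) powr (q - 2)) \<longlonglongrightarrow> K * 0"
    using q bmax_over_x
    by (intro tendsto_mult tendsto_const tendsto_zero_powrI[where b = "q - 2"])
      (auto intro: eventually_mono[OF eventually_x_ge[of 0]] simp: less_imp_le[OF bmax_pos])
  then have small: "eventually (\<lambda>n. K * (bmax n / x n) powr (q - 2) < 1) sequentially"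
    by (intro order_tendstoD) auto
  show thesis
  proof (rule that[OF K(1)])
    show "eventually (\<lambda>n. \<P>(\<omega> in M. x n \<le> (\<Sum>i\<in>I n. min (b n i * Z i \<omega>) (e * x n)))
      \<le> exp 1 * (exp (- exp (- q) / 2 * (x n)\<^sup>2) + (K * (bmax n / x n) powr (q - 2)) powr (1 / (2 * e)))) sequentially"
      using small eventually_x_ge[of 1]
    proof eventually_elim
      case (elim n)
      then have x: "1 \<le> x n" by simp
      interpret S: centered_summands M "I n" "\<lambda>i \<omega>. b n i * Z i \<omega>"
        by (rule summands)
      have eq: "max 0 (b n i * z) powr q = b n i powr q * max 0 z powr q" if "i \<in> I n" for i z
      proof -
        have "max 0 (b n i * z) = b n i * max 0 z"
          using b_pos[OF that] by (simp add: max_def mult_le_0_iff zero_le_mult_iff)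
        then show ?thesis
          using b_pos[OF that] by (simp add: powr_mult)
      qed
      have int: "integrable M (\<lambda>\<omega>. max 0 (b n i * Z i \<omega>) powr q)" if "i \<in> I n" for i
        unfolding eq[OF that] using q
        by (intro integrable_mult_right integrable_Z[of "\<lambda>z. max 0 z powr q"]
          tail.integrable_positive_part_powr) auto
      have ex: "expectation (\<lambda>\<omega>. max 0 (b n i * Z i \<omega>) powr q) = b n i powr q * m" if "i \<in> I n" for i
        unfolding eq[OF that] m_def using expectation_Z[of "\<lambda>z. max 0 z powr q" i] by simp
      have bq: "b n i powr q \<le> bmax n powr (q - 2) * (b n i)\<^sup>2" if "i \<in> I n" for i
      proof -
        have "b n i powr q = b n i powr (q - 2) * (b n i)\<^sup>2"
          using b_pos[OF that] by (simp add: powr_diff)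
        also have "\<dots> \<le> bmax n powr (q - 2) * (b n i)\<^sup>2"
          using b_pos[OF that] b_le_bmax[OF that] q by (intro mult_right_mono powr_mono2) auto
        finally show ?thesis .
      qed
      have "(\<Sum>i\<in>I n. b n i powr q) \<le> (\<Sum>i\<in>I n. bmax n powr (q - 2) * (b n i)\<^sup>2)"
        using bq by (rule sum_mono)
      then have sb: "(\<Sum>i\<in>I n. b n i powr q) \<le> bmax n powr (q - 2)"
        by (simp add: b_normed flip: sum_distrib_left)
      have "(e * x n) powr - q * (\<Sum>i\<in>I n. expectation (\<lambda>\<omega>. max 0 (b n i * Z i \<omega>) powr q))
          = e powr - q * m * (x n powr - q * (\<Sum>i\<in>I n. b n i powr q))"
        using ex e x by (simp add: powr_mult sum_distrib_right sum_distrib_left mult_ac)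
      \<comment> \<open>Since \<open>x n \<ge> 1\<close>, \<open>x n powr - q\<close> is at most
        \<open>x n powr - (q - 2)\<close>, which pairs with the power of
        \<open>bmax n\<close>.\<close>
      also have "\<dots> \<le> K * (x n powr - (q - 2) * bmax n powr (q - 2))"
        using sb K x q \<open>0 \<le> m\<close> by (intro mult_mono powr_mono) (auto intro!: mult_nonneg_nonneg sum_nonneg)
      also have "\<dots> = K * (bmax n / x n) powr (q - 2)"
        using x bmax_pos[of n] by (simp only: powr_minus powr_divide) (simp add: field_simps)
      finally have B: "(e * x n) powr - q * (\<Sum>i\<in>I n. expectation (\<lambda>\<omega>. max 0 (b n i * Z i \<omega>) powr q))
        \<le> K * (bmax n / x n) powr (q - 2)" .
      have "\<P>(\<omega> in M. x n \<le> (\<Sum>i\<in>I n. min (b n i * Z i \<omega>) (e * x n)))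
        \<le> exp 1 * (exp (- exp (- q) / 2 * (x n)\<^sup>2)
          + (K * (bmax n / x n) powr (q - 2)) powr (x n / (2 * (e * x n))))"
        using x e q int B elim K bmax_pos[of n] total_var_eq[of n]
        by (intro S.Fuk_Nagaev) (auto simp: zero_less_mult_iff)
      then show ?case
        using x by simp
    qed
  qed
qed

text \<open>Each Fuk-Nagaev term is compared with its own lower bound for \<open>G 1\<close>: the
  Gaussian term with the one from \<open>D\<^sup>2\<close>, the power term with the one from the
  largest weight.\<close>

lemma remainder_negligible:
  obtains e where "0 < e"
    and "(\<lambda>n. \<P>(\<omega> in M. x n \<le> (\<Sum>i\<in>I n. min (b n i * Z i \<omega>) (e * x n))) / G 1 n) \<longlonglongrightarrow> 0"
proof -
  txt \<open>With this \<open>e\<close> the Fuk-Nagaev power term is of order \<open>(bmax / x) powr (T + 1)\<close>,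
    one power below the lower bound for \<open>G 1\<close>.\<close>
  define q T where "q = (t + 2) / 2" and "T = 2 * t - 2"
  have q: "2 < q" "q < t" and T: "0 < T" using tail.t_gt_2 by (auto simp: q_def T_def)
  define e where "e = (q - 2) / (2 * (T + 1))"
  have e: "0 < e" "(q - 2) * (1 / (2 * e)) = T + 1"
    using q T by (auto simp: e_def field_simps)
  obtain K where K: "0 < K" and up: "eventually (\<lambda>n. \<P>(\<omega> in M. x n \<le> (\<Sum>i\<in>I n. min (b n i * Z i \<omega>) (e * x n)))
    \<le> exp 1 * (exp (- exp (- q) / 2 * (x n)\<^sup>2) + (K * (bmax n / x n) powr (q - 2)) powr (1 / (2 * e)))) sequentially"
    by (rule remainder_bound[OF q e(1)])
  obtain a where a: "0 < a"
    and low1: "eventually (\<lambda>n. a * (bmax n / x n) powr T \<le> G 1 n) sequentially"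
    and low2: "eventually (\<lambda>n. a * (x n powr - T * exp (- 2 * (x n)\<^sup>2 / C\<^sup>2)) \<le> G 1 n) sequentially"
    unfolding T_def by (rule G_ge)
  \<comment> \<open>\<open>d\<close> is what remains of the Gaussian exponent after division by the
    exponential in the lower bound. Its positivity is where the size of \<open>C\<close> enters,
    through \<open>4 * exp q < 4 * exp t < C\<^sup>2\<close>.\<close>
  define d where "d = exp (- q) / 2 - 2 / C\<^sup>2"
  have d: "0 < d"
  proof -
    have "4 * exp q < C\<^sup>2"
      using C_gt q exp_less_mono[of q t] by linarith
    then show ?thesis
      using C_pos unfolding d_def exp_minus by (simp add: field_simps)
  qed
  define K' where "K' = K powr (1 / (2 * e))"
  \<comment> \<open>\<open>u n\<close> collects what is left after division by \<open>G 1 n\<close>: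
    a power of \<open>x n\<close> times a Gaussian, and one spare power of
    \<open>bmax n / x n\<close>.\<close>
  define u where "u n = exp 1 / a * (x n powr T * exp (- d * (x n)\<^sup>2) + K' * (bmax n / x n))" for n
  have "((\<lambda>y::real. y powr T * exp (- d * y\<^sup>2)) \<longlongrightarrow> 0) at_top"
    using d T by real_asymp
  from filterlim_compose[OF this x_tendsto]
  have "u \<longlonglongrightarrow> exp 1 / a * (0 + K' * 0)"
    unfolding u_def by (intro tendsto_intros bmax_over_x)
  then have u: "u \<longlonglongrightarrow> 0" by simp
  have "eventually (\<lambda>n. norm (\<P>(\<omega> in M. x n \<le> (\<Sum>i\<in>I n. min (b n i * Z i \<omega>) (e * x n))) / G 1 n) \<le> u n) sequentially"
    using up low1 low2 eventually_x_ge[of 1]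
  proof eventually_elim
    case (elim n)
    then have x: "1 \<le> x n" by simp
    define r where "r = bmax n / x n"
    have r: "0 < r" using x bmax_pos[of n] by (simp add: r_def)
    have g: "0 < G 1 n" by (rule G_pos)
    have "exp (- exp (- q) / 2 * (x n)\<^sup>2) = exp (- d * (x n)\<^sup>2) * exp (- 2 * (x n)\<^sup>2 / C\<^sup>2)"
      unfolding exp_add[symmetric] d_def by (simp add: algebra_simps)
    also have "\<dots> = (x n powr T * exp (- d * (x n)\<^sup>2)) / a * (a * (x n powr - T * exp (- 2 * (x n)\<^sup>2 / C\<^sup>2)))"
      using x a by (simp add: powr_minus)
    also have "\<dots> \<le> (x n powr T * exp (- d * (x n)\<^sup>2)) / a * G 1 n"
      using elim a by (intro mult_left_mono) auto
    finally have 1: "exp (- exp (- q) / 2 * (x n)\<^sup>2) \<le> (x n powr T * exp (- d * (x n)\<^sup>2)) / a * G 1 n" .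
    have "(K * r powr (q - 2)) powr (1 / (2 * e)) = K' * r powr (T + 1)"
      using K r e(2) unfolding K'_def by (simp add: powr_mult powr_powr)
    also have "\<dots> = (K' * r) / a * (a * r powr T)"
      using r a by (simp add: powr_add)
    also have "\<dots> \<le> (K' * r) / a * G 1 n"
      using elim a r unfolding r_def[symmetric] K'_def by (intro mult_left_mono) auto
    finally have 2: "(K * r powr (q - 2)) powr (1 / (2 * e)) \<le> (K' * r) / a * G 1 n" .
    have "\<P>(\<omega> in M. x n \<le> (\<Sum>i\<in>I n. min (b n i * Z i \<omega>) (e * x n)))
        \<le> exp 1 * ((x n powr T * exp (- d * (x n)\<^sup>2)) / a * G 1 n + (K' * r) / a * G 1 n)"
      using 1 2 by (intro order_trans[OF elim(1)] mult_left_mono add_mono) (auto simp: r_def)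
    also have "\<dots> = u n * G 1 n"
      unfolding u_def r_def by (simp add: algebra_simps add_divide_distrib)
    finally show ?case
      using g by (simp add: divide_le_eq)
  qed
  then have "(\<lambda>n. \<P>(\<omega> in M. x n \<le> (\<Sum>i\<in>I n. min (b n i * Z i \<omega>) (e * x n))) / G 1 n) \<longlonglongrightarrow> 0"
    using u by (rule Lim_null_comparison)
  with e(1) that show thesis by blast
qed

section \<open>Combination of the lower and upper bounds\<close>

text \<open>For fixed \<open>s\<close> the lower and upper bounds converge in \<open>n\<close> to
  \<open>(1 + s) powr - t\<close> and \<open>(1 - s) powr - t\<close>, which approach 1 as
  \<open>s\<close> shrinks. For each \<open>c\<close> a single suitable \<open>s\<close> is
  therefore enough.\<close>

lemma prob_weighted_sum_asymp:
  "(\<lambda>n. \<P>(\<omega> in M. x n \<le> (\<Sum>i\<in>I n. b n i * Z i \<omega>)) / G 1 n) \<longlonglongrightarrow> 1" (is "?P \<longlonglongrightarrow> 1")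
proof -
  have inv: "(\<lambda>n. 1 / (s * x n)\<^sup>2) \<longlonglongrightarrow> 0" if "0 < s" for s
  proof -
    have "filterlim (\<lambda>n. (s * x n)\<^sup>2) at_top sequentially"
      using that x_tendsto
      by (intro filterlim_pow_at_top filterlim_tendsto_pos_mult_at_top[OF tendsto_const]) auto
    from tendsto_inverse_0_at_top[OF this] show ?thesis
      by (simp add: divide_inverse)
  qed
  have powr_lim: "((\<lambda>s. (1 + c * s) powr - t) \<longlongrightarrow> 1) (at_right 0)" for c :: real
  proof -
    have "((\<lambda>s. (1 + c * s) powr - t) \<longlongrightarrow> (1 + c * 0) powr - t) (at_right 0)"
      by (intro tendsto_intros) simp
    then show ?thesis by simp
  qed
  have in_01: "eventually (\<lambda>s::real. 0 < s \<and> s < 1) (at_right 0)"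
    unfolding eventually_at_right_field by (intro exI[of _ 1]) auto
  show ?thesis
  proof (rule order_tendstoI)
    fix c :: real assume "c < 1"
    have "eventually (\<lambda>s. (c < (1 + 1 * s) powr - t) \<and> 0 < s \<and> s < 1) (at_right 0)"
      by (intro eventually_conj order_tendstoD(1)[OF powr_lim \<open>c < 1\<close>] in_01)
    then obtain s :: real where s: "c < (1 + s) powr - t" "0 < s"
      using eventually_happens'[OF trivial_limit_at_right_real] by fastforce
    have "(\<lambda>n. G (1 + s) n / G 1 n * (1 - 1 / (s * x n)\<^sup>2 - G (1 + s) n))
        \<longlonglongrightarrow> (1 + s) powr - t * (1 - 0 - 0)"
      using s by (intro tendsto_intros G_ratio G_tendsto_0 inv) auto
    then have "eventually (\<lambda>n. c < G (1 + s) n / G 1 n * (1 - 1 / (s * x n)\<^sup>2 - G (1 + s) n)) sequentially"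
      using s by (intro order_tendstoD) auto
    then show "eventually (\<lambda>n. c < ?P n) sequentially"
      using eventually_x_ge[of 1]
    proof eventually_elim
      case (elim n)
      have "G (1 + s) n * (1 - 1 / (s * x n)\<^sup>2 - G (1 + s) n)
          \<le> \<P>(\<omega> in M. x n \<le> (\<Sum>i\<in>I n. b n i * Z i \<omega>))"
        using centered_summands.prob_sum_ge_lower[OF summands, of "s * x n" n "x n"]
          elim s tail_sum_eq[of n "1 + s"]
        by (simp add: total_var_eq distrib_right)
      then have "G (1 + s) n * (1 - 1 / (s * x n)\<^sup>2 - G (1 + s) n) / G 1 n \<le> ?P n"
        using G_pos[of 1 n] by (intro divide_right_mono) auto
      then show ?case
        using elim by simp
    qed
  next
    fix c :: real assume "1 < c"
    have "eventually (\<lambda>s. ((1 + (- 1) * s) powr - t < c) \<and> 0 < s \<and> s < 1) (at_right 0)"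
      by (intro eventually_conj order_tendstoD(2)[OF powr_lim \<open>1 < c\<close>] in_01)
    then obtain s :: real where s: "(1 - s) powr - t < c" "0 < s" "s < 1"
      using eventually_happens'[OF trivial_limit_at_right_real] by fastforce
    obtain e where e: "0 < e"
      and R: "(\<lambda>n. \<P>(\<omega> in M. x n \<le> (\<Sum>i\<in>I n. min (b n i * Z i \<omega>) (e * x n))) / G 1 n) \<longlonglongrightarrow> 0"
      (is "(\<lambda>n. ?R n / _) \<longlonglongrightarrow> 0")
      by (rule remainder_negligible)
    \<comment> \<open>As \<open>e\<close> stays fixed, \<open>G e n / G 1 n\<close> has the finite
      limit \<open>e powr - t\<close>, and it is multiplied by a factor that tends to 0.\<close>
    have "(\<lambda>n. G (1 - s) n / G 1 n + G e n / G 1 n * (1 / (s * x n)\<^sup>2 + G e n) + ?R n / G 1 n)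
        \<longlonglongrightarrow> (1 - s) powr - t + e powr - t * (0 + 0) + 0"
      using s e by (intro tendsto_intros G_ratio G_tendsto_0 inv R) auto
    then have "eventually (\<lambda>n. G (1 - s) n / G 1 n + G e n / G 1 n * (1 / (s * x n)\<^sup>2 + G e n)
        + ?R n / G 1 n < c) sequentially"
      using s by (intro order_tendstoD) auto
    then show "eventually (\<lambda>n. ?P n < c) sequentially"
      using eventually_x_ge[of 1]
    proof eventually_elim
      case (elim n)
      have "\<P>(\<omega> in M. x n \<le> (\<Sum>i\<in>I n. b n i * Z i \<omega>))
          \<le> G (1 - s) n + G e n * (1 / (s * x n)\<^sup>2 + G e n) + ?R n"
        using centered_summands.prob_sum_ge_upper[OF summands, of "s * x n" "x n" n "e * x n"]
          elim s tail_sum_eq[of n "1 - s"] tail_sum_eq[of n e]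
        by (simp add: total_var_eq left_diff_distrib)
      then have "?P n \<le> (G (1 - s) n + G e n * (1 / (s * x n)\<^sup>2 + G e n) + ?R n) / G 1 n"
        using G_pos[of 1 n] by (intro divide_right_mono) auto
      then show ?case
        using elim by (simp add: add_divide_distrib)
    qed
  qed
qed

end

section \<open>Sequences of independent identically distributed variables\<close>

text \<open>Needed to pass from integer to natural indices. Events indexed by \<open>J\<close> are
  transported by \<open>inv g\<close> to the image of \<open>J\<close>, where the given independence
  applies.\<close>

lemma (in prob_space) indep_vars_reindex:
  assumes "indep_vars M' X UNIV" and "inj g"
  shows "indep_vars (\<lambda>i. M' (g i)) (\<lambda>i. X (g i)) UNIV"
proof -
  let ?E = "\<lambda>i. {X i -` A \<inter> space M |A. A \<in> sets (M' i)}"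
  have ind: "indep_sets ?E UNIV" and rv: "\<And>i. random_variable (M' i) (X i)"
    using assms(1) unfolding indep_vars_def2 by auto
  have "indep_sets (\<lambda>i. ?E (g i)) UNIV"
  proof (rule indep_setsI)
    fix A J
    assume J: "J \<noteq> {}" "finite J" and A: "\<forall>j\<in>J. A j \<in> ?E (g j)"
    have "prob (\<Inter>j\<in>g ` J. A (inv g j)) = (\<Prod>j\<in>g ` J. prob (A (inv g j)))"
      using J A assms(2) by (intro indep_setsD[OF ind]) auto
    then show "prob (\<Inter>j\<in>J. A j) = (\<Prod>j\<in>J. prob (A j))"
      using assms(2) by (simp add: prod.reindex inj_on_subset[OF assms(2)])
  qed (use rv in auto)
  then show ?thesis
    using rv unfolding indep_vars_def2 by auto
qed

text \<open>In the ratio of two tails the powers leave \<open>l powr - t\<close>, and slow variation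
  sends the ratio of the values of \<open>h\<close> to 1.\<close>

lemma (in prob_space) iid_regular_tail:
  assumes iid: "iid M \<xi>"
    and sq: "integrable M (\<lambda>\<omega>. (\<xi> 0 \<omega>)\<^sup>2)"
    and mean: "expectation (\<xi> 0) = 0"
    and t: "t > 2"
    and h: "slowly_varying h"
    and tail: "eventually (\<lambda>y. \<P>(\<omega> in M. \<xi> 0 \<omega> \<ge> y) = h y / y powr t) at_top"
  defines "\<sigma> \<equiv> sqrt (expectation (\<lambda>\<omega>. (\<xi> 0 \<omega>)\<^sup>2))"
  defines "N \<equiv> distr M borel (\<lambda>\<omega>. \<xi> 0 \<omega> / \<sigma>)"
  shows "0 < \<sigma>" and "regular_tail N t"
    and "\<And>y. measure N {y..} = \<P>(\<omega> in M. \<sigma> * y \<le> \<xi> 0 \<omega>)"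
proof -
  let ?v = "expectation (\<lambda>\<omega>. (\<xi> 0 \<omega>)\<^sup>2)"
  have rv [measurable]: "random_variable borel (\<xi> 0)"
    using iid unfolding iid_def indep_vars_def by auto
  have ev: "eventually (\<lambda>y. \<P>(\<omega> in M. \<xi> 0 \<omega> \<ge> y) = h y / y powr t \<and> 0 < h y \<and> 0 < y) at_top"
    using h unfolding slowly_varying_def by (intro eventually_conj tail eventually_gt_at_top) auto
  then have ev_pos: "eventually (\<lambda>y. 0 < \<P>(\<omega> in M. y \<le> \<xi> 0 \<omega>) \<and> 0 < y) at_top"
    by eventually_elim auto
  \<comment> \<open>Positivity holds far out, where \<open>h\<close> is positive, and spreads to all
    \<open>y\<close> because the tail is decreasing.\<close>
  have pos: "0 < \<P>(\<omega> in M. y \<le> \<xi> 0 \<omega>)" for y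
  proof -
    obtain y' where y': "y \<le> y'" "0 < \<P>(\<omega> in M. y' \<le> \<xi> 0 \<omega>)"
      using eventually_happens'[OF trivial_limit_at_top_linorder
          eventually_conj[OF ev_pos eventually_ge_at_top[of y]]] by auto
    note y'(2)
    also have "\<P>(\<omega> in M. y' \<le> \<xi> 0 \<omega>) \<le> \<P>(\<omega> in M. y \<le> \<xi> 0 \<omega>)"
      using y'(1) by (intro finite_measure_mono) auto
    finally show ?thesis .
  qed
  \<comment> \<open>A vanishing second moment would make \<open>\<xi> 0\<close> zero almost surely,
    against the positive tail at 1.\<close>
  have "?v \<noteq> 0"
  proof
    assume "?v = 0"
    then have "AE \<omega> in M. (\<xi> 0 \<omega>)\<^sup>2 = 0"
      using integral_nonneg_eq_0_iff_AE[OF sq] by simp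
    then have "AE \<omega> in M. \<not> 1 \<le> \<xi> 0 \<omega>"
      by eventually_elim simp
    then have "\<P>(\<omega> in M. 1 \<le> \<xi> 0 \<omega>) = 0"
      by (intro prob_eq_0_AE) auto
    with pos[of 1] show False by simp
  qed
  moreover have "0 \<le> ?v" by simp
  ultimately have v: "0 < ?v" by linarith
  then show \<sigma>: "0 < \<sigma>" by (simp add: \<sigma>_def)
  have \<sigma>2: "\<sigma>\<^sup>2 = ?v" using v by (simp add: \<sigma>_def)
  have F: "measure N {y..} = \<P>(\<omega> in M. \<sigma> * y \<le> \<xi> 0 \<omega>)" for y
    unfolding N_def using \<sigma>
    by (subst measure_distr) (auto intro!: arg_cong[where f = prob] simp: field_simps)
  then show "\<And>y. measure N {y..} = \<P>(\<omega> in M. \<sigma> * y \<le> \<xi> 0 \<omega>)" .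
  interpret N: prob_space N
    unfolding N_def by (rule prob_space_distr) simp
  show "regular_tail N t"
  proof
    show "sets N = sets borel" by (simp add: N_def)
    show "t > 2" by fact
    show "integrable N (\<lambda>z. z\<^sup>2)"
      unfolding N_def using sq by (simp add: integrable_distr_eq power_divide)
    show "integral\<^sup>L N (\<lambda>z. z\<^sup>2) = 1"
      unfolding N_def using v \<sigma>2 by (simp add: integral_distr power_divide)
    show "integral\<^sup>L N (\<lambda>z. z) = 0"
      unfolding N_def using mean by (simp add: integral_distr)
    show "0 < measure N {y..}" for y
      unfolding F by (rule pos)
    fix l :: real assume l: "0 < l"
    have at: "filterlim (\<lambda>y. s * y) at_top at_top" if "0 < s" for s :: real
      using that by (intro filterlim_tendsto_pos_mult_at_top[OF tendsto_const] filterlim_ident)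
    have "((\<lambda>y. h (l * y) / h y) \<longlongrightarrow> 1) at_top"
      using h l unfolding slowly_varying_def by blast
    from tendsto_mult_right[OF filterlim_compose[OF this at[OF \<sigma>]], of "l powr - t"]
    have "((\<lambda>y. h (l * (\<sigma> * y)) / h (\<sigma> * y) * l powr - t) \<longlongrightarrow> l powr - t) at_top"
      by (simp add: mult_ac)
    moreover have "eventually (\<lambda>y. h (l * (\<sigma> * y)) / h (\<sigma> * y) * l powr - t =
        measure N {l * y..} / measure N {y..}) at_top"
      using eventually_compose_filterlim[OF ev at[OF \<sigma>]]
        eventually_compose_filterlim[OF ev at[OF mult_pos_pos[OF l \<sigma>]]]
    proof eventually_elim
      case (elim y)
      define a where "a = \<sigma> * y"
      have eq: "l * \<sigma> * y = l * a" "\<sigma> * (l * y) = l * a" "\<sigma> * y = a"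
        by (simp_all add: a_def)
      show ?case
        using elim l unfolding F eq by (simp add: powr_mult powr_minus field_simps)
    qed
    ultimately show "((\<lambda>y. measure N {l * y..} / measure N {y..}) \<longlongrightarrow> l powr - t) at_top"
      by (rule Lim_transform_eventually)
  qed
qed

section \<open>Return to the original weights\<close>

theorem theorem2p2:
  fixes M :: "'a measure" and \<xi> :: "int \<Rightarrow> 'a \<Rightarrow> real"
    and h :: "real \<Rightarrow> real" and t C :: real
    and k :: "nat \<Rightarrow> nat" and c :: "nat \<Rightarrow> nat \<Rightarrow> real" and x :: "nat \<Rightarrow> real"
  assumes "prob_space M"
    and "iid M \<xi>"
    and "integrable M (\<lambda>\<omega>. (\<xi> 0 \<omega>)\<^sup>2)"
    and "prob_space.expectation M (\<xi> 0) = 0"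
    and "t > 2"
    and "slowly_varying h"
    and "eventually (\<lambda>y. \<P>(\<omega> in M. \<xi> 0 \<omega> \<ge> y) = h y / y powr t) at_top"
    and "\<And>n. n \<ge> 1 \<Longrightarrow> k n \<ge> 1"
    and "\<And>n i. n \<ge> 1 \<Longrightarrow> 1 \<le> i \<Longrightarrow> i \<le> k n \<Longrightarrow> c n i > 0"
    and "(\<lambda>n. MAX i\<in>{1..k n}. (c n i)\<^sup>2 / (sd_sum M k c \<xi> n)\<^sup>2) \<longlonglongrightarrow> 0"
    and "C > exp (t / 2) * (t + 2) / sqrt 2"
    and "\<And>n. n \<ge> 1 \<Longrightarrow> x n \<ge> C * sqrt (ln (inverse (D_ratio k c t n)))"
  shows "\<exists>\<epsilon>. \<epsilon> \<longlonglongrightarrow> 0 \<and>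
    (\<forall>\<^sub>F n in sequentially.
       \<P>(\<omega> in M. weighted_sum k c \<xi> n \<omega> \<ge> x n * sd_sum M k c \<xi> n) =
       (1 + \<epsilon> n) * (\<Sum>i=1..k n. \<P>(\<omega> in M. c n i * \<xi> 0 \<omega> \<ge> x n * sd_sum M k c \<xi> n)))"
proof -
  interpret prob_space M by fact
  define \<sigma> where "\<sigma> = sqrt (expectation (\<lambda>\<omega>. (\<xi> 0 \<omega>)\<^sup>2))"
  define N where "N = distr M borel (\<lambda>\<omega>. \<xi> 0 \<omega> / \<sigma>)"
  note reg = iid_regular_tail[OF assms(2-7), folded \<sigma>_def, folded N_def]
  have \<sigma>: "0 < \<sigma>" by (rule reg)
  have ind: "indep_vars (\<lambda>_. borel) \<xi> UNIV"
    and dd: "\<And>i. distr M borel (\<xi> i) = distr M borel (\<xi> 0)"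
    using assms(2) unfolding iid_def by blast+
  have rv [measurable]: "random_variable borel (\<xi> i)" for i
    using ind by (auto simp: indep_vars_def)
  define s where "s n = sqrt (\<Sum>i=1..k n. (c n i)\<^sup>2)" for n
  have s2: "(s n)\<^sup>2 = (\<Sum>i=1..k n. (c n i)\<^sup>2)" for n
    unfolding s_def by (simp add: sum_nonneg)
  have s: "0 < s n" if "1 \<le> n" for n
    unfolding s_def using assms(8)[OF that] assms(9)[OF that]
    by (auto intro!: sum_pos simp: less_imp_neq[symmetric])
  have sd: "sd_sum M k c \<xi> n = \<sigma> * s n" for n
  proof (rule power2_eq_imp_eq)
    show "(sd_sum M k c \<xi> n)\<^sup>2 = (\<sigma> * s n)\<^sup>2"
      using sd_sum_squared[OF assms(1-4), of k c n] by (simp add: power_mult_distrib s2 \<sigma>_def)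
    show "0 \<le> sd_sum M k c \<xi> n"
      by (simp add: sd_sum_def)
    show "0 \<le> \<sigma> * s n"
      using \<sigma> by (simp add: s_def sum_nonneg)
  qed
  have C: "0 < C" "4 * exp t < C\<^sup>2"
  proof -
    let ?c = "exp (t / 2) * (t + 2) / sqrt 2"
    have c: "0 < ?c" using assms(5) by simp
    then show "0 < C" using assms(11) by simp
    \<comment> \<open>As \<open>t > 2\<close>, the factor \<open>(t + 2)\<^sup>2 / 2\<close> exceeds
      8; the right-hand side is the square of the given bound for \<open>C\<close>.\<close>
    have "4 * exp t \<le> (t + 2)\<^sup>2 / 2 * exp t"
      using power_mono[of 4 "t + 2" 2] assms(5) by (intro mult_right_mono) auto
    also have "\<dots> = ?c\<^sup>2"
      by (simp add: power_mult_distrib power_divide flip: exp_double)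
    also have "\<dots> < C\<^sup>2"
      using c assms(11) by (intro power_strict_mono) auto
    finally show "4 * exp t < C\<^sup>2" .
  qed
  \<comment> \<open>The hypotheses speak of \<open>n \<ge> 1\<close>, while the locale asks for
    every \<open>n\<close>; hence the shift to \<open>Suc n\<close>.\<close>
  define b where "b n i = c (Suc n) i / s (Suc n)" for n i
  define Z where "Z i \<omega> = \<xi> (int i) \<omega> / \<sigma>" for i \<omega>
  interpret W: weighted_array M N t Z "\<lambda>n. {1..k (Suc n)}" b "\<lambda>n. x (Suc n)" C
  proof (intro weighted_array.intro weighted_array_axioms.intro)
    show "prob_space M" by fact
    show "regular_tail N t" by (rule reg)
    have "indep_vars (\<lambda>_. borel) (\<lambda>i. \<xi> (int i)) UNIV"
      using indep_vars_reindex[OF ind, of int] by simp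
    then show "indep_vars (\<lambda>_. borel) Z UNIV"
      unfolding Z_def by (rule indep_vars_compose2[where Y = "\<lambda>_ z. z / \<sigma>"]) simp
    show "distr M borel (Z i) = N" for i
    proof -
      have "distr M borel (Z i) = distr (distr M borel (\<xi> (int i))) borel (\<lambda>z. z / \<sigma>)"
        unfolding Z_def by (simp add: distr_distr comp_def)
      also have "\<dots> = N"
        unfolding dd[of "int i"] N_def by (simp add: distr_distr comp_def)
      finally show ?thesis .
    qed
    show "{1..k (Suc n)} \<noteq> {}" for n
      using assms(8)[of "Suc n"] by simp
    show b_pos: "0 < b n i" if "i \<in> {1..k (Suc n)}" for n i
      using that assms(9)[of "Suc n" i] s[of "Suc n"] by (simp add: b_def)
    show "(\<Sum>i\<in>{1..k (Suc n)}. (b n i)\<^sup>2) = 1" for n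
      using s[of "Suc n"] unfolding b_def power_divide sum_divide_distrib[symmetric] s2[symmetric]
      by simp
    \<comment> \<open>The square of the largest \<open>b n i\<close> is
      \<open>\<sigma>\<^sup>2\<close> times one of the ratios whose maximum is assumed to
      vanish.\<close>
    show "(\<lambda>n. Max (b n ` {1..k (Suc n)})) \<longlonglongrightarrow> 0"
    proof (rule Lim_null_comparison)
      let ?m = "\<lambda>n. MAX i\<in>{1..k n}. (c n i)\<^sup>2 / (sd_sum M k c \<xi> n)\<^sup>2"
      have "(\<lambda>n. sqrt (\<sigma>\<^sup>2 * ?m (Suc n))) \<longlonglongrightarrow> sqrt (\<sigma>\<^sup>2 * 0)"
        using LIMSEQ_Suc[OF assms(10)] by (intro tendsto_intros)
      then show "(\<lambda>n. sqrt (\<sigma>\<^sup>2 * ?m (Suc n))) \<longlonglongrightarrow> 0" by simp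
      show "eventually (\<lambda>n. norm (Max (b n ` {1..k (Suc n)})) \<le> sqrt (\<sigma>\<^sup>2 * ?m (Suc n))) sequentially"
      proof (rule always_eventually, rule allI)
        fix n
        have "Max (b n ` {1..k (Suc n)}) \<in> b n ` {1..k (Suc n)}"
          using assms(8)[of "Suc n"] by (intro Max_in) auto
        then obtain i where i: "i \<in> {1..k (Suc n)}" "Max (b n ` {1..k (Suc n)}) = b n i"
          by blast
        have "(b n i)\<^sup>2 = \<sigma>\<^sup>2 * ((c (Suc n) i)\<^sup>2 / (sd_sum M k c \<xi> (Suc n))\<^sup>2)"
          using \<sigma> by (simp add: b_def sd power_mult_distrib power_divide)
        also have "\<dots> \<le> \<sigma>\<^sup>2 * ?m (Suc n)"
          using i(1) by (intro mult_left_mono Max_ge) auto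
        finally show "norm (Max (b n ` {1..k (Suc n)})) \<le> sqrt (\<sigma>\<^sup>2 * ?m (Suc n))"
          unfolding i(2) using b_pos[OF i(1)] by (simp add: real_le_rsqrt)
      qed
    qed
    \<comment> \<open>\<open>D_ratio\<close> is invariant under rescaling of the weights, so it
      equals the power sum of the normalised ones.\<close>
    show "C * sqrt (ln (inverse (\<Sum>i\<in>{1..k (Suc n)}. b n i powr t))) \<le> x (Suc n)" for n
    proof -
      have "(\<Sum>i\<in>{1..k (Suc n)}. b n i powr t) = (\<Sum>i\<in>{1..k (Suc n)}. s (Suc n) powr - t * c (Suc n) i powr t)"
        using s[of "Suc n"] assms(9)[of "Suc n"]
        by (intro sum.cong) (auto simp: b_def powr_divide powr_minus field_simps less_imp_le)
      moreover have "s (Suc n) powr - t = (\<Sum>i=1..k (Suc n). (c (Suc n) i)\<^sup>2) powr (- t / 2)"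
        unfolding s_def by (simp add: powr_powr sum_nonneg flip: powr_half_sqrt)
      ultimately have "(\<Sum>i\<in>{1..k (Suc n)}. b n i powr t) = D_ratio k c t (Suc n)"
        unfolding D_ratio_def by (simp add: sum_distrib_left)
      then show ?thesis using assms(12)[of "Suc n"] by simp
    qed
  qed (use C in auto)
  define p where "p n = \<P>(\<omega> in M. weighted_sum k c \<xi> n \<omega> \<ge> x n * sd_sum M k c \<xi> n)" for n
  define g where "g n = (\<Sum>i=1..k n. \<P>(\<omega> in M. c n i * \<xi> 0 \<omega> \<ge> x n * sd_sum M k c \<xi> n))" for n
  have p: "p (Suc n) = \<P>(\<omega> in M. x (Suc n) \<le> (\<Sum>i\<in>{1..k (Suc n)}. b n i * Z i \<omega>))" for n
  proof -
    have "weighted_sum k c \<xi> (Suc n) \<omega> = (\<Sum>i\<in>{1..k (Suc n)}. b n i * Z i \<omega>) * (\<sigma> * s (Suc n))" for \<omega>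
      using \<sigma> s[of "Suc n"] by (simp add: weighted_sum_def b_def Z_def sum_distrib_right)
    then show ?thesis
      using \<sigma> s[of "Suc n"] by (simp add: p_def sd)
  qed
  have g: "g (Suc n) = W.G 1 n" for n
    unfolding g_def W.G_def reg(3)
  proof (intro sum.cong refl arg_cong[where f = prob] Collect_cong conj_cong)
    fix i \<omega> assume "i \<in> {1..k (Suc n)}"
    then show "x (Suc n) * sd_sum M k c \<xi> (Suc n) \<le> c (Suc n) i * \<xi> 0 \<omega>
        \<longleftrightarrow> \<sigma> * (1 * (x (Suc n) / b n i)) \<le> \<xi> 0 \<omega>"
      using \<sigma> s[of "Suc n"] assms(9)[of "Suc n" i] by (simp add: sd b_def field_simps)
  qed
  \<comment> \<open>The witness for the error term is \<open>p n / g n - 1\<close>. Undoing the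
    shift adds only the index 0, which does not affect the limit.\<close>
  have "(\<lambda>n. p (Suc n) / g (Suc n) - 1) \<longlonglongrightarrow> 1 - 1"
    unfolding p g by (intro tendsto_diff tendsto_const W.prob_weighted_sum_asymp)
  then have "(\<lambda>n. p n / g n - 1) \<longlonglongrightarrow> 0"
    by (auto intro: LIMSEQ_imp_Suc[where f = "\<lambda>n. p n / g n - 1"])
  moreover have "eventually (\<lambda>n. p n = (1 + (p n / g n - 1)) * g n) sequentially"
    using eventually_ge_at_top[of "1::nat"]
  proof eventually_elim
    case (elim n)
    then have "0 < g n"
      using g[of "n - 1"] W.G_pos[of 1 "n - 1"] by simp
    then show ?case by simp
  qed
  ultimately show ?thesis
    unfolding p_def g_def by (intro exI conjI)
qed

end
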